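(* Let $U:\mathbb{R}^d\to\mathbb{R}$ satisfy the following two conditions. (i) $U$ is twice continuously differentiable, $\nabla U(0)=0$, and there is $\mathtt{L}\ge 0$ with $\sup_{x\in\mathbb{R}^d}\|\mathrm{D}^2U(x)\|\le \mathtt{L}$. (ii) There exist $\mathtt{m}>0$ and $\mathtt{K}\ge 0$ such that $\mathrm{D}^2U(x)[y,y]\ge \mathtt{m}$ for all $x,y\in\mathbb{R}^d$ with $\|x\|\ge \mathtt{K}$ and $\|y\|=1$. Let $\bar\eta=\mathtt{m}/16$ and $V_{\bar\eta}(x)=\exp(\bar\eta\|x\|^2)$. Then there exists $\Gamma>0$ such that for every $\gamma\in(0,\Gamma]$ there exist $C_\gamma\ge 0$ and $\rho_\gamma\in[0,1)$ such that for all $x\in\mathbb{R}^d$ and all $k\in\mathbb{N}$, $$\|\delta_x R_\gamma^k-\pi\|_{V_{\bar\eta}}\le C_\gamma\rho_\gamma^k V_{\bar\eta}(x).$$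
   Context: $\pi$ denotes the probability density on $\mathbb{R}^d$ proportional to $e^{-U}$ (the paper assumes $\pi$ is a positive probability density with $U=-\log\pi$), and also the associated probability measure. For $\gamma>0$, let $r_\gamma(x,y)=(4\pi\gamma)^{-d/2}\exp(-\|y-x+\gamma\nabla U(x)\|^2/(4\gamma))$ and $\alpha_\gamma(x,y)=1\wedge \frac{\pi(y)r_\gamma(y,x)}{\pi(x)r_\gamma(x,y)}$. The MALA Markov kernel is $R_\gamma(x,A)=\int \mathbb{1}_A(y)\alpha_\gamma(x,y)r_\gamma(x,y)\,dy+\delta_x(A)\int\{1-\alpha_\gamma(x,y)\}r_\gamma(x,y)\,dy$. For a measurable $V:\mathbb{R}^d\to[1,\infty)$ and a finite signed measure $\mu$, $\|\mu\|_V=\sup\{|\int f\,d\mu|: f \text{ measurable}, \sup_x|f(x)|/V(x)\le 1\}$. *)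

theory Defs
  imports "HOL-Probability.Probability"
begin

definition Zc :: "('a::euclidean_space \<Rightarrow> real) \<Rightarrow> real" where
  "Zc U = (\<integral>y. exp (- U y) \<partial>lborel)"

definition pi_dens :: "('a::euclidean_space \<Rightarrow> real) \<Rightarrow> 'a \<Rightarrow> real" where
  "pi_dens U y = exp (- U y) / Zc U"

definition pi_meas :: "('a::euclidean_space \<Rightarrow> real) \<Rightarrow> 'a measure" where
  "pi_meas U = density lborel (\<lambda>y. ennreal (pi_dens U y))"

text \<open>Proposal density r_gamma(x,y); G is the gradient of U.\<close>
definition prop_dens :: "('a::euclidean_space \<Rightarrow> 'a) \<Rightarrow> real \<Rightarrow> 'a \<Rightarrow> 'a \<Rightarrow> real" where
  "prop_dens G \<gamma> x y =
     (4 * pi * \<gamma>) powr (- real DIM('a) / 2) * exp (- (norm (y - x + \<gamma> *\<^sub>R G x))\<^sup>2 / (4 * \<gamma>))"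

definition acc_prob :: "('a::euclidean_space \<Rightarrow> real) \<Rightarrow> ('a \<Rightarrow> 'a) \<Rightarrow> real \<Rightarrow> 'a \<Rightarrow> 'a \<Rightarrow> real" where
  "acc_prob U G \<gamma> x y =
     min 1 ((pi_dens U y * prop_dens G \<gamma> y x) / (pi_dens U x * prop_dens G \<gamma> x y))"

definition mala_kernel :: "('a::euclidean_space \<Rightarrow> real) \<Rightarrow> ('a \<Rightarrow> 'a) \<Rightarrow> real \<Rightarrow> 'a \<Rightarrow> 'a measure" where
  "mala_kernel U G \<gamma> x = measure_of UNIV (sets borel)
     (\<lambda>A. ennreal ((\<integral>y. indicator A y * acc_prob U G \<gamma> x y * prop_dens G \<gamma> x y \<partial>lborel)
        + indicator A x * (\<integral>y. (1 - acc_prob U G \<gamma> x y) * prop_dens G \<gamma> x y \<partial>lborel)))"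

fun mala_iter :: "('a::euclidean_space \<Rightarrow> real) \<Rightarrow> ('a \<Rightarrow> 'a) \<Rightarrow> real \<Rightarrow> 'a \<Rightarrow> nat \<Rightarrow> 'a measure" where
  "mala_iter U G \<gamma> x 0 = return borel x"
| "mala_iter U G \<gamma> x (Suc k) = mala_iter U G \<gamma> x k \<bind> mala_kernel U G \<gamma>"

text \<open>V-norm of the signed measure M - N; infinite unless V is integrable
  with respect to both measures (i.e. unless the V-norm is meaningful).\<close>
definition vnorm :: "('a::euclidean_space \<Rightarrow> real) \<Rightarrow> 'a measure \<Rightarrow> 'a measure \<Rightarrow> ereal" where
  "vnorm V M N =
     (if integrable M V \<and> integrable N V then
        (SUP f \<in> {f. f \<in> borel_measurable borel \<and> (\<forall>x. \<bar>f x\<bar> \<le> V x)}.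
            ereal \<bar>(\<integral>y. f y \<partial>M) - (\<integral>y. f y \<partial>N)\<bar>)
      else \<infinity>)"

end

theory Submission
  imports Defs
begin

text \<open>
  The claim follows from Harris' theorem for the kernel \<open>R\<close> of the algorithm, which is reversible with
  respect to \<open>\<pi>\<close>, once a drift condition \<open>R V \<le> l V + b\<close> with \<open>l < 1\<close> and a minorization on the
  sublevel sets of \<open>V\<close> are known. The minorization holds because the density of accepted moves is
  positive and jointly continuous.

  For the drift, \<open>R V \<le> Q V + V rej\<close>, where \<open>Q\<close> is the Gaussian proposal kernel and \<open>rej\<close> the rejection
  probability. A Gaussian computation shows that \<open>Q V / V\<close> tends to \<open>0\<close> at infinity. Moreover, if
  \<open>\<gamma> \<le> m / (2 L\<^sup>2)\<close> and \<open>x\<close> is far from the origin, every proposal whose noise has norm at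
  most \<open>1\<close> is accepted with probability \<open>1\<close>, so that \<open>rej\<close> stays away from \<open>1\<close>.

  Harris' theorem is proved following Hairer and Mattingly: for \<open>W = 1 + \<beta> V\<close> with small \<open>\<beta>\<close>, one step
  of the chain contracts the oscillation seminorm \<open>sup (\<bar>f x - f y\<bar> / (W x + W y))\<close>, and this seminorm
  equals the \<open>W\<close>-weighted supremum norm modulo constants.
\<close>

section \<open>Harris' theorem\<close>

locale drift_kernel =
  fixes K :: "'a::topological_space \<Rightarrow> 'a measure" and V :: "'a \<Rightarrow> real" and l b :: real
  assumes kernel [measurable]: "K \<in> borel \<rightarrow>\<^sub>M prob_algebra borel"
    and V_measurable [measurable]: "V \<in> borel_measurable borel"
    and V_nonneg: "\<And>x. 0 \<le> V x"
    and l: "0 \<le> l" "l < 1" and b: "0 \<le> b"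
    and drift: "\<And>x. (\<integral>\<^sup>+y. ennreal (V y) \<partial>K x) \<le> ennreal (l * V x + b)"
begin

lemma kernel_subprob [measurable]: "K \<in> borel \<rightarrow>\<^sub>M subprob_algebra borel"
  using kernel by (rule measurable_prob_algebraD)

lemma sets_kernel_eq [simp, measurable_cong]: "sets (K x) = sets borel"
  using measurable_space[OF kernel, of x] by (simp add: space_prob_algebra)

lemma space_kernel_eq [simp]: "space (K x) = UNIV"
  using sets_eq_imp_space_eq[OF sets_kernel_eq] by simp

lemma prob_space_kernel: "prob_space (K x)"
  using measurable_space[OF kernel, of x] by (simp add: space_prob_algebra)

text \<open>The function space on which \<open>P\<close> acts. The weight is \<open>1 + V\<close>
  because \<open>V\<close> may vanish while constants have to belong to the space.\<close>

definition dominated :: "('a \<Rightarrow> real) \<Rightarrow> bool" where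
  "dominated f \<longleftrightarrow> f \<in> borel_measurable borel \<and> (\<exists>A. \<forall>x. \<bar>f x\<bar> \<le> A * (1 + V x))"

definition P :: "('a \<Rightarrow> real) \<Rightarrow> 'a \<Rightarrow> real" where
  "P f x = (\<integral>y. f y \<partial>K x)"

lemma dominated_measurable: "dominated f \<Longrightarrow> f \<in> borel_measurable borel"
  by (simp add: dominated_def)

lemma integrable_dominated:
  assumes mu: "prob_space \<mu>" "sets \<mu> = sets borel" "integrable \<mu> V" and f: "dominated f"
  shows "integrable \<mu> f"
proof -
  interpret prob_space \<mu> by fact
  from f obtain A where A: "\<And>x. \<bar>f x\<bar> \<le> A * (1 + V x)" and [measurable]: "f \<in> borel_measurable borel"
    unfolding dominated_def by blast
  show ?thesis
  proof (rule Bochner_Integration.integrable_bound)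
    show "integrable \<mu> (\<lambda>x. A * (1 + V x))" using mu by simp
    show "f \<in> borel_measurable \<mu>" by (simp add: mu(2) cong: measurable_cong_sets)
    show "AE x in \<mu>. norm (f x) \<le> norm (A * (1 + V x))"
      using A by (intro AE_I2) (simp, meson abs_ge_self order_trans)
  qed
qed

text \<open>Finiteness comes from \<open>drift\<close>, which is stated with the nonnegative
  integral so that it presupposes no integrability.\<close>

lemma integrable_kernel_V: "integrable (K x) V"
  using drift[of x] V_nonneg
  by (auto intro!: integrableI_nonneg intro: le_less_trans simp: ennreal_less_top)

lemma integrable_kernel: "dominated f \<Longrightarrow> integrable (K x) f"
  by (rule integrable_dominated) (simp_all add: prob_space_kernel integrable_kernel_V)

lemma P_V_le: "P V x \<le> l * V x + b"
proof -
  have "ennreal (P V x) = (\<integral>\<^sup>+y. ennreal (V y) \<partial>K x)"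
    unfolding P_def using integrable_kernel_V V_nonneg
    by (subst nn_integral_eq_integral) auto
  then show ?thesis
    using drift[of x] V_nonneg[of x] l b ennreal_le_iff[of "l * V x + b" "P V x"] by simp
qed

text \<open>A bound \<open>A * (1 + V)\<close> on \<open>f\<close> becomes
  \<open>A * (1 + P V)\<close>, and the drift brings \<open>P V\<close> back to \<open>V\<close>.
  Hence \<open>P\<close> can be iterated.\<close>

lemma dominated_P:
  assumes "dominated f" shows "dominated (P f)"
proof -
  from assms obtain A where A: "\<And>x. \<bar>f x\<bar> \<le> A * (1 + V x)" and [measurable]: "f \<in> borel_measurable borel"
    unfolding dominated_def by blast
  have A0: "0 \<le> A"
  proof -
    \<comment> \<open>Any point would do; \<open>undefined\<close> is merely available.\<close>
    have "0 \<le> A * (1 + V undefined)" using A[of undefined] by linarith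
    moreover have "0 < 1 + V undefined" using V_nonneg[of undefined] by linarith
    ultimately show ?thesis by (simp add: zero_le_mult_iff)
  qed
  have "\<bar>P f x\<bar> \<le> (A * (1 + b)) * (1 + V x)" for x
  proof -
    interpret prob_space "K x" by (rule prob_space_kernel)
    have "\<bar>P f x\<bar> \<le> (\<integral>y. \<bar>f y\<bar> \<partial>K x)"
      unfolding P_def by (rule integral_abs_bound)
    also have "\<dots> \<le> (\<integral>y. A * (1 + V y) \<partial>K x)"
      using A integrable_kernel[OF assms] integrable_kernel_V by (intro integral_mono) auto
    also have "\<dots> = A * (1 + P V x)"
      using integrable_kernel_V prob_space by (simp add: P_def)
    also have "\<dots> \<le> A * (1 + (l * V x + b))"
      using A0 P_V_le by (intro mult_left_mono) auto
    also have "\<dots> \<le> A * ((1 + b) * (1 + V x))"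
    proof (intro mult_left_mono A0)
      have "l * V x \<le> 1 * V x" using l V_nonneg by (intro mult_right_mono) auto
      moreover have "0 \<le> b * V x" using b V_nonneg by simp
      ultimately show "1 + (l * V x + b) \<le> (1 + b) * (1 + V x)" by (simp add: algebra_simps)
    qed
    finally show ?thesis by (simp add: mult.assoc)
  qed
  moreover have "P f \<in> borel_measurable borel"
    unfolding P_def by measurable
  ultimately show ?thesis unfolding dominated_def by blast
qed

lemma dominated_V: "dominated V"
  unfolding dominated_def using V_nonneg by (auto intro!: exI[of _ 1])

lemma dominated_affine: "dominated f \<Longrightarrow> dominated (\<lambda>x. c * f x + d)"
proof -
  assume "dominated f"
  then obtain A where A: "\<And>x. \<bar>f x\<bar> \<le> A * (1 + V x)" and [measurable]: "f \<in> borel_measurable borel"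
    unfolding dominated_def by blast
  have "\<bar>c * f x + d\<bar> \<le> (\<bar>c\<bar> * A + \<bar>d\<bar>) * (1 + V x)" for x
  proof -
    have "\<bar>c * f x + d\<bar> \<le> \<bar>c\<bar> * \<bar>f x\<bar> + \<bar>d\<bar>" by (metis abs_mult abs_triangle_ineq)
    also have "\<dots> \<le> \<bar>c\<bar> * (A * (1 + V x)) + \<bar>d\<bar> * (1 + V x)"
      using A V_nonneg[of x] by (intro add_mono mult_left_mono) (auto simp: mult_le_cancel_left1 algebra_simps)
    finally show ?thesis by (simp add: algebra_simps)
  qed
  then show ?thesis unfolding dominated_def by auto
qed

lemma P_affine:
  assumes "dominated f" shows "P (\<lambda>x. c * f x + d) x = c * P f x + d"
proof -
  interpret prob_space "K x" by (rule prob_space_kernel)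
  show ?thesis using integrable_kernel[OF assms] prob_space by (simp add: P_def)
qed

section \<open>One step of the chain from an arbitrary initial law\<close>

context
  fixes \<mu> assumes mu: "prob_space \<mu>" "sets \<mu> = sets borel" "integrable \<mu> V"
begin

lemma bind_kernel_prob: "prob_space (\<mu> \<bind> K)" "sets (\<mu> \<bind> K) = sets borel"
  using mu by (auto intro!: prob_space_bind'[OF _ kernel] sets_bind'[OF _ kernel] simp: space_prob_algebra)

lemma kernel_measurable_mu [measurable]: "K \<in> \<mu> \<rightarrow>\<^sub>M subprob_algebra borel"
  using kernel_subprob by (simp add: mu(2) cong: measurable_cong_sets)

text \<open>Nonnegative integrals pass through the bind without conditions; domination makes them
  finite, which allows the return to \<open>P\<close>.\<close>

lemma integral_bind_nonneg:
  assumes f: "dominated f" "\<And>x. 0 \<le> f x"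
  shows "(\<integral>\<^sup>+x. ennreal (f x) \<partial>(\<mu> \<bind> K)) = ennreal (\<integral>x. P f x \<partial>\<mu>)"
proof -
  have [measurable]: "f \<in> borel_measurable borel" using f by (simp add: dominated_def)
  have nn: "0 \<le> P f x" for x unfolding P_def using f by (intro Bochner_Integration.integral_nonneg) auto
  have "(\<integral>\<^sup>+x. ennreal (f x) \<partial>(\<mu> \<bind> K)) = (\<integral>\<^sup>+x. \<integral>\<^sup>+y. ennreal (f y) \<partial>K x \<partial>\<mu>)"
    by (rule nn_integral_bind[where B=borel]) auto
  also have "\<dots> = (\<integral>\<^sup>+x. ennreal (P f x) \<partial>\<mu>)"
    unfolding P_def using f integrable_kernel
    by (intro nn_integral_cong nn_integral_eq_integral) auto
  also have "\<dots> = ennreal (\<integral>x. P f x \<partial>\<mu>)"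
    using nn integrable_dominated[OF mu dominated_P[OF f(1)]] by (intro nn_integral_eq_integral) auto
  finally show ?thesis .
qed

lemma integrable_bind_V: "integrable (\<mu> \<bind> K) V"
  using integral_bind_nonneg[OF dominated_V V_nonneg] V_nonneg
  by (auto intro!: integrableI_nonneg simp: bind_kernel_prob(2) ennreal_less_top cong: measurable_cong_sets)

text \<open>A signed \<open>f\<close> is the difference of the nonnegative dominated functions
  \<open>g = f + h\<close> and \<open>h = A * V + A\<close>, to which the previous equation
  applies.\<close>

lemma integral_bind_kernel:
  assumes f: "dominated f"
  shows "(\<integral>x. f x \<partial>(\<mu> \<bind> K)) = (\<integral>x. P f x \<partial>\<mu>)"
proof -
  from f obtain A where A: "\<And>x. \<bar>f x\<bar> \<le> A * (1 + V x)" and [measurable]: "f \<in> borel_measurable borel"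
    unfolding dominated_def by blast
  define h where "h x = A * V x + A" for x
  define g where "g x = f x + h x" for x
  have h: "dominated h" unfolding h_def by (rule dominated_affine[OF dominated_V])
  have hf: "\<bar>f x\<bar> \<le> h x" for x using A[of x] by (simp add: h_def algebra_simps)
  have g: "dominated g"
    using A dominated_measurable[OF h] unfolding dominated_def g_def h_def
    by (auto intro!: exI[of _ "2 * A"] simp: abs_le_iff algebra_simps) (smt (verit) A mult_left_mono distrib_left)+
  have real: "(\<integral>x. u x \<partial>(\<mu> \<bind> K)) = (\<integral>x. P u x \<partial>\<mu>)"
    if u: "dominated u" "\<And>x. 0 \<le> u x" for u
  proof -
    have "0 \<le> (\<integral>x. P u x \<partial>\<mu>)"
      unfolding P_def using u by (intro Bochner_Integration.integral_nonneg) auto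
    then show ?thesis
      using integral_bind_nonneg[OF u] u dominated_measurable[OF u(1)]
      by (subst integral_eq_nn_integral) (auto simp: bind_kernel_prob(2) cong: measurable_cong_sets)
  qed
  have g0: "0 \<le> g x" and h0: "0 \<le> h x" for x using hf[of x] by (auto simp: g_def)
  note ib = integrable_dominated[OF bind_kernel_prob integrable_bind_V]
  have "(\<integral>x. f x \<partial>(\<mu> \<bind> K)) = (\<integral>x. g x - h x \<partial>(\<mu> \<bind> K))" by (simp add: g_def)
  also have "\<dots> = (\<integral>x. P g x \<partial>\<mu>) - (\<integral>x. P h x \<partial>\<mu>)"
    using ib[OF g] ib[OF h] real[OF g g0] real[OF h h0] by simp
  also have "\<dots> = (\<integral>x. P g x - P h x \<partial>\<mu>)"
    using integrable_dominated[OF mu] dominated_P g h by simp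
  also have "\<dots> = (\<integral>x. P f x \<partial>\<mu>)"
    using integrable_kernel[OF f] integrable_kernel[OF h] by (simp add: P_def g_def[abs_def])
  finally show ?thesis .
qed

end

text \<open>The recursion of \<open>mala_iter\<close> for an abstract kernel; the two are identified
  in \<open>geometric_ergodicity\<close>.\<close>

definition iter :: "'a \<Rightarrow> nat \<Rightarrow> 'a measure" where
  "iter x k = ((\<lambda>\<mu>. \<mu> \<bind> K) ^^ k) (return borel x)"

lemma iter_props: "prob_space (iter x k) \<and> sets (iter x k) = sets borel \<and> integrable (iter x k) V"
proof (induction k)
  case 0
  have "integrable (return borel x) V"
    using V_nonneg by (intro integrableI_nonneg) (auto simp: nn_integral_return ennreal_less_top)
  then show ?case by (simp add: iter_def prob_space_return)
next
  case (Suc k)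
  then show ?case
    using bind_kernel_prob[of "iter x k"] integrable_bind_V[of "iter x k"] by (simp add: iter_def)
qed

text \<open>The induction varies \<open>f\<close>: the outermost bind replaces \<open>f\<close> by
  \<open>P f\<close>.\<close>

lemma integral_iter: "dominated f \<Longrightarrow> (\<integral>y. f y \<partial>iter x k) = (P ^^ k) f x"
proof (induction k arbitrary: f)
  case 0
  then show ?case using dominated_measurable by (simp add: iter_def integral_return)
next
  case (Suc k)
  have "(\<integral>y. f y \<partial>iter x (Suc k)) = (\<integral>y. P f y \<partial>iter x k)"
    using integral_bind_kernel[of "iter x k"] iter_props[of x k] Suc.prems by (simp add: iter_def)
  also have "\<dots> = (P ^^ k) (P f) x" using Suc dominated_P by simp
  finally show ?case by (simp add: funpow_swap1)
qed

lemma dominated_P_power: "dominated f \<Longrightarrow> dominated ((P ^^ k) f)"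
  by (induction k) (auto intro: dominated_P)

lemma integral_invariant:
  assumes "prob_space \<mu>" "sets \<mu> = sets borel" "integrable \<mu> V" "\<mu> \<bind> K = \<mu>" "dominated f"
  shows "(\<integral>y. (P ^^ k) f y \<partial>\<mu>) = (\<integral>y. f y \<partial>\<mu>)"
proof (induction k)
  case (Suc k)
  then show ?case
    using integral_bind_kernel[OF assms(1-3) dominated_P_power[OF assms(5)], of k] assms(4) by simp
qed simp

end

section \<open>Contraction of the weighted oscillation\<close>

lemma oscillation_le_imp_centered:
  fixes f W :: "'a \<Rightarrow> real"
  assumes "\<And>x y. \<bar>f x - f y\<bar> \<le> W x + W y"
  shows "\<exists>c. \<forall>x. \<bar>f x + c\<bar> \<le> W x"
proof -
  \<comment> \<open>By assumption every \<open>- W y - f y\<close> lies below every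
    \<open>W x - f x\<close>. Any \<open>c\<close> in between works, and the infimum of the latter
    is one.\<close>
  define c where "c = (INF x. W x - f x)"
  have *: "- W y - f y \<le> W x - f x" for x y using assms[of x y] by linarith
  then have "bdd_below (range (\<lambda>x. W x - f x))" by (intro bdd_belowI[of _ "- W undefined - f undefined"]) auto
  then have "c \<le> W x - f x" for x unfolding c_def by (rule cINF_lower) simp
  moreover have "- W x - f x \<le> c" for x unfolding c_def by (rule cINF_greatest) (auto simp: *)
  ultimately have "\<bar>f x + c\<bar> \<le> W x" for x by (auto simp: abs_le_iff algebra_simps) (smt (verit))+
  then show ?thesis by blast
qed

text \<open>The factor \<open>4\<close> ensures that, if \<open>V x + V y \<ge> R\<close>, the
  constant \<open>2 * b\<close> of two drift bounds costs at most half of the gap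
  \<open>1 - l\<close>.\<close>

locale harris_kernel = drift_kernel +
  fixes R \<epsilon> :: real and \<nu> :: "'a measure"
  assumes R: "4 * b / (1 - l) \<le> R" "0 < R" and eps: "0 < \<epsilon>"
    and nu: "prob_space \<nu>" "sets \<nu> = sets borel"
    and minorization: "\<And>x g. V x \<le> R \<Longrightarrow> g \<in> borel_measurable borel \<Longrightarrow>
          ennreal \<epsilon> * (\<integral>\<^sup>+y. g y \<partial>\<nu>) \<le> (\<integral>\<^sup>+y. g y \<partial>K x)"
begin

text \<open>Small enough that the drift constants of two points, \<open>2 * \<beta> * b\<close>
  together, stay below \<open>\<epsilon>\<close>; the \<open>+ 1\<close> covers
  \<open>b = 0\<close>.\<close>

definition \<beta> :: real where "\<beta> = \<epsilon> / (2 * (b + 1))"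

text \<open>The first entry is the contraction factor for pairs with
  \<open>V x + V y \<ge> R\<close>. For the other pairs \<open>1 - \<epsilon> / 2\<close> controls
  the constant part of \<open>W x + W y\<close>, and \<open>l\<close> the part with
  \<open>V\<close>.\<close>

definition rate :: real where
  "rate = max ((2 + \<beta> * ((1 + l) / 2) * R) / (2 + \<beta> * R)) (max (1 - \<epsilon> / 2) l)"

definition W :: "'a \<Rightarrow> real" where "W x = 1 + \<beta> * V x"

lemma beta: "0 < \<beta>" "2 * \<beta> * b \<le> \<epsilon>"
  using eps b by (auto simp: \<beta>_def field_simps)

lemma rate: "0 \<le> rate" "rate < 1"
proof -
  show "0 \<le> rate" using l by (simp add: rate_def max_def)
  have "\<beta> * ((1 + l) / 2) * R < \<beta> * R" using beta R l by (simp add: field_simps)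
  moreover have "0 < 2 + \<beta> * R" using beta R by (simp add: add_pos_pos)
  ultimately show "rate < 1" using eps l by (simp add: rate_def field_simps)
qed

lemma W_ge_1: "1 \<le> W x"
  using beta V_nonneg by (simp add: W_def)

lemma dominated_W: "dominated W"
  unfolding W_def[abs_def] using dominated_affine[OF dominated_V, of \<beta> 1] by (simp add: add.commute)

lemma P_W_le: "P W x \<le> 1 + \<beta> * (l * V x + b)"
proof -
  have "P W x = \<beta> * P V x + 1"
    using P_affine[OF dominated_V, of \<beta> 1 x] by (simp add: W_def[abs_def] add.commute)
  then show ?thesis using P_V_le[of x] beta by simp
qed

lemma abs_P_le:
  assumes f: "dominated f" "\<And>x. \<bar>f x\<bar> \<le> a * W x"
  shows "\<bar>P f x\<bar> \<le> a * P W x"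
proof -
  have "\<bar>P f x\<bar> \<le> (\<integral>y. \<bar>f y\<bar> \<partial>K x)" unfolding P_def by (rule integral_abs_bound)
  also have "\<dots> \<le> (\<integral>y. a * W y \<partial>K x)"
    using f integrable_kernel[OF f(1)] integrable_kernel[OF dominated_W] by (intro integral_mono) auto
  finally show ?thesis by (simp add: P_def)
qed

text \<open>The minorization makes \<open>K x - \<epsilon> \<nu>\<close> nonnegative. It is applied
  to \<open>a * W + f\<close> and \<open>a * W - f\<close>, both nonnegative; the gain
  \<open>a * \<epsilon>\<close> appears because \<open>W\<close> has \<open>\<nu>\<close>-integral
  at least \<open>1\<close>.\<close>

lemma abs_P_diff_le:
  assumes f: "dominated f" "\<And>x. \<bar>f x\<bar> \<le> a * W x" and x: "V x \<le> R" and a: "0 \<le> a"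
  shows "\<bar>P f x - \<epsilon> * (\<integral>y. f y \<partial>\<nu>)\<bar> \<le> a * (P W x - \<epsilon>)"
proof -
  interpret nu: prob_space \<nu> by (rule nu)
  \<comment> \<open>The minorization with \<open>g = V\<close> bounds the
    \<open>\<nu>\<close>-integral of \<open>V\<close> by the finite one under
    \<open>K x\<close>.\<close>
  have "ennreal \<epsilon> * (\<integral>\<^sup>+y. ennreal (V y) \<partial>\<nu>) < \<infinity>"
    using le_less_trans[OF order_trans[OF minorization[OF x, of "\<lambda>y. ennreal (V y)"] drift[of x]] ennreal_less_top] by simp
  then have "(\<integral>\<^sup>+y. ennreal (V y) \<partial>\<nu>) < \<infinity>"
    using eps by (auto simp: ennreal_mult_less_top)
  then have nuV: "integrable \<nu> V"
    using V_nonneg by (auto intro!: integrableI_nonneg simp: nu(2) cong: measurable_cong_sets)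
  note inu = integrable_dominated[OF nu nuV]
  have le: "\<epsilon> * (\<integral>y. g y \<partial>\<nu>) \<le> P g x" if g: "dominated g" "\<And>x. 0 \<le> g x" for g
  proof -
    have "ennreal (\<epsilon> * (\<integral>y. g y \<partial>\<nu>)) = ennreal \<epsilon> * (\<integral>\<^sup>+y. ennreal (g y) \<partial>\<nu>)"
      using eps g inu[OF g(1)] by (subst nn_integral_eq_integral) (auto simp: ennreal_mult')
    also have "\<dots> \<le> (\<integral>\<^sup>+y. ennreal (g y) \<partial>K x)"
      using dominated_measurable[OF g(1)] by (intro minorization[OF x]) auto
    also have "\<dots> = ennreal (P g x)"
      unfolding P_def using g integrable_kernel[OF g(1)] by (intro nn_integral_eq_integral) auto
    finally show ?thesis
      unfolding P_def using g by (subst (asm) ennreal_le_iff) (auto intro!: Bochner_Integration.integral_nonneg)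
  qed
  have W1: "1 \<le> (\<integral>y. W y \<partial>\<nu>)"
    using integral_mono[of \<nu> "\<lambda>_. 1" W] inu[OF dominated_W] W_ge_1 by (simp add: nu.prob_space)
  have *: "\<epsilon> * (a * (\<integral>y. W y \<partial>\<nu>) + s * (\<integral>y. f y \<partial>\<nu>)) \<le> a * P W x + s * P f x" if s: "s \<in> {-1, 1}" for s
  proof -
    have d: "dominated (\<lambda>y. a * W y + s * f y)"
    proof -
      have "\<bar>a * W y + s * f y\<bar> \<le> 2 * (a * W y)" for y using f(2)[of y] s by auto
      moreover obtain A where A: "\<And>y. \<bar>W y\<bar> \<le> A * (1 + V y)" using dominated_W unfolding dominated_def by blast
      have "2 * (a * W y) \<le> (2 * a * A) * (1 + V y)" for y
        using mult_left_mono[OF order_trans[OF abs_ge_self A[of y]], of "2 * a"] a by (simp add: mult.assoc)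
      ultimately have "\<bar>a * W y + s * f y\<bar> \<le> (2 * a * A) * (1 + V y)" for y by (meson order_trans)
      then show ?thesis
        unfolding dominated_def using dominated_measurable[OF f(1)] dominated_measurable[OF dominated_W] by auto
    qed
    have n: "0 \<le> a * W y + s * f y" for y using f(2)[of y] s by auto
    show ?thesis using le[OF d n] inu[OF dominated_W] inu[OF f(1)] integrable_kernel[OF dominated_W] integrable_kernel[OF f(1)]
      by (simp add: P_def)
  qed
  have "\<epsilon> * a \<le> \<epsilon> * (a * (\<integral>y. W y \<partial>\<nu>))"
    using W1 eps a by (simp add: mult_le_cancel_left1)
  then show ?thesis using *[of 1] *[of "-1"] by (auto simp: abs_le_iff algebra_simps)
qed

text \<open>Pairs with \<open>V x + V y \<ge> R\<close> are contracted by the drift alone. Otherwise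
  both points satisfy \<open>V \<le> R\<close>, and the common part \<open>\<epsilon> \<nu>\<close>
  of the two kernels cancels in the difference.\<close>

lemma P_oscillation:
  assumes f: "dominated f" "\<And>x. \<bar>f x\<bar> \<le> a * W x" and a: "0 \<le> a"
  shows "\<bar>P f x - P f y\<bar> \<le> rate * a * W x + rate * a * W y"
proof -
  define S where "S = V x + V y"
  have S0: "0 \<le> S" using V_nonneg by (simp add: S_def)
  define l' where "l' = (1 + l) / 2"
  have WS: "W x + W y = 2 + \<beta> * S" by (simp add: W_def S_def algebra_simps)
  have PWS: "P W x + P W y \<le> 2 + \<beta> * (l * S + 2 * b)"
    using P_W_le[of x] P_W_le[of y] by (simp add: S_def algebra_simps)
  \<comment> \<open>The witness is \<open>P W x + P W y\<close>, reduced by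
    \<open>2 * \<epsilon>\<close> in the second case.\<close>
  have "\<exists>t. \<bar>P f x - P f y\<bar> \<le> a * t \<and> t \<le> rate * (2 + \<beta> * S)"
  proof (cases "R \<le> S")
    case True
    define r1 where "r1 = (2 + \<beta> * l' * R) / (2 + \<beta> * R)"
    have den: "0 < 2 + \<beta> * R" using beta R by (simp add: add_pos_pos)
    have r1: "r1 * (2 + \<beta> * R) = 2 + \<beta> * l' * R" using den by (simp add: r1_def)
    \<comment> \<open>\<open>r1\<close> is a weighted mean of \<open>1\<close> and
      \<open>l'\<close>, hence at least \<open>l'\<close>. The inequality \<open>A\<close> below is
      an equality at \<open>S = R\<close>, and beyond \<open>R\<close> its left side has the smaller
      slope.\<close>
    have "l' * (2 + \<beta> * R) \<le> 2 + \<beta> * l' * R" using l by (simp add: l'_def algebra_simps)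
    then have "l' \<le> r1" using den by (simp add: r1_def pos_le_divide_eq)
    then have "\<beta> * (S - R) * l' \<le> \<beta> * (S - R) * r1" using True beta by (intro mult_left_mono) auto
    then have A: "2 + \<beta> * (l' * S) \<le> r1 * (2 + \<beta> * S)" using r1 by (simp add: algebra_simps)
    have "4 * b \<le> R * (1 - l)" using R l by (simp add: pos_divide_le_eq)
    also have "\<dots> \<le> S * (1 - l)" using True l by (intro mult_right_mono) auto
    finally have "l * S + 2 * b \<le> l' * S" by (simp add: l'_def algebra_simps)
    then have "2 + \<beta> * (l * S + 2 * b) \<le> 2 + \<beta> * (l' * S)" using beta by simp
    also note A
    also have "r1 * (2 + \<beta> * S) \<le> rate * (2 + \<beta> * S)"
      using beta S0 by (intro mult_right_mono) (auto simp: rate_def r1_def l'_def)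
    finally have "P W x + P W y \<le> rate * (2 + \<beta> * S)" using PWS by simp
    moreover have "\<bar>P f x - P f y\<bar> \<le> a * (P W x + P W y)"
      using abs_P_le[OF f, of x] abs_P_le[OF f, of y] by (simp add: algebra_simps)
    ultimately show ?thesis by blast
  next
    case False
    then have xy: "V x \<le> R" "V y \<le> R" using V_nonneg[of x] V_nonneg[of y] by (auto simp: S_def)
    have "\<bar>P f x - P f y\<bar> \<le> a * (P W x + P W y - 2 * \<epsilon>)"
      using abs_P_diff_le[OF f xy(1) a] abs_P_diff_le[OF f xy(2) a] by (simp add: algebra_simps)
    moreover have "P W x + P W y - 2 * \<epsilon> \<le> rate * (2 + \<beta> * S)"
    proof -
      \<comment> \<open>Half of the gain \<open>2 * \<epsilon>\<close> pays for the drift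
        constants.\<close>
      have "P W x + P W y - 2 * \<epsilon> \<le> 2 * (1 - \<epsilon> / 2) + l * (\<beta> * S)"
        using PWS beta(2) by (simp add: algebra_simps)
      also have "\<dots> \<le> 2 * rate + rate * (\<beta> * S)"
        using beta S0 by (intro add_mono mult_left_mono mult_right_mono) (auto simp: rate_def)
      finally show ?thesis by (simp add: algebra_simps)
    qed
    ultimately show ?thesis by blast
  qed
  then obtain t where t: "\<bar>P f x - P f y\<bar> \<le> a * t" "t \<le> rate * (W x + W y)" by (auto simp: WS)
  have "a * t \<le> a * (rate * (W x + W y))" using t(2) a by (rule mult_left_mono)
  with t(1) show ?thesis by (simp add: algebra_simps)
qed

text \<open>Contraction and recentering alternate: a bound by \<open>a * W\<close> yields an
  oscillation bound with \<open>rate * a\<close>, hence a bound by \<open>rate * a * W\<close> after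
  a shift. Shifts pass through \<open>P\<close> because it preserves constants.\<close>

lemma P_power_centered:
  assumes f: "dominated f" "\<And>x. \<bar>f x\<bar> \<le> W x"
  shows "\<exists>c. \<forall>x. \<bar>(P ^^ k) f x + c\<bar> \<le> rate ^ k * W x"
proof (induction k)
  case 0
  then show ?case using f by (auto intro!: exI[of _ 0])
next
  case (Suc k)
  then obtain c where c: "\<And>x. \<bar>(P ^^ k) f x + c\<bar> \<le> rate ^ k * W x" by blast
  define g where "g x = (P ^^ k) f x + c" for x
  have Pk: "dominated ((P ^^ k) f)" by (rule dominated_P_power[OF f(1)])
  have g: "dominated g" using dominated_affine[OF Pk, of 1 c] by (simp add: g_def[abs_def])
  have Pg: "P g x = (P ^^ Suc k) f x + c" for x
    using P_affine[OF Pk, of 1 c x] by (simp add: g_def[abs_def])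
  have "\<exists>d. \<forall>x. \<bar>P g x + d\<bar> \<le> rate * rate ^ k * W x"
    by (rule oscillation_le_imp_centered, rule P_oscillation[OF g]) (use c rate in \<open>auto simp: g_def\<close>)
  then show ?case by (auto simp: Pg add.assoc)
qed

text \<open>The unknown shift \<open>c\<close> is eliminated by integrating the centered bound
  against \<open>\<mu>\<close>, whose invariance turns \<open>(P ^^ k) g\<close> into
  \<open>g\<close>.\<close>

theorem harris:
  assumes mu: "prob_space \<mu>" "sets \<mu> = sets borel" "integrable \<mu> V" and inv: "\<mu> \<bind> K = \<mu>"
    and f: "f \<in> borel_measurable borel" "\<And>x. \<bar>f x\<bar> \<le> V x"
  shows "\<bar>(\<integral>y. f y \<partial>iter x k) - (\<integral>y. f y \<partial>\<mu>)\<bar> \<le> rate ^ k * (W x + (\<integral>y. W y \<partial>\<mu>)) / \<beta>"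
proof -
  interpret mu: prob_space \<mu> by fact
  have df: "dominated f"
    unfolding dominated_def using f by (auto intro!: exI[of _ 1] simp: add_increasing)
  \<comment> \<open>Scaling makes a function bounded by \<open>V\<close> bounded by
    \<open>W\<close>; \<open>\<beta>\<close> is divided out at the end.\<close>
  define g where "g x = \<beta> * f x" for x
  have g: "dominated g" using dominated_affine[OF df, of \<beta> 0] by (simp add: g_def[abs_def])
  have "\<bar>g x\<bar> \<le> W x" for x
    using f(2)[of x] beta by (simp add: g_def W_def abs_mult) (smt (verit) mult_left_mono)
  from P_power_centered[OF g this, of k] obtain c where
    c: "\<And>x. \<bar>(P ^^ k) g x + c\<bar> \<le> rate ^ k * W x" by blast
  have Pk: "dominated ((P ^^ k) g)" by (rule dominated_P_power[OF g])
  have "\<bar>\<integral>y. (P ^^ k) g y + c \<partial>\<mu>\<bar> \<le> (\<integral>y. \<bar>(P ^^ k) g y + c\<bar> \<partial>\<mu>)" by (rule integral_abs_bound)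
  also have "\<dots> \<le> (\<integral>y. rate ^ k * W y \<partial>\<mu>)"
    using c integrable_dominated[OF mu Pk] integrable_dominated[OF mu dominated_W] by (intro integral_mono) auto
  finally have "\<bar>(\<integral>y. g y \<partial>\<mu>) + c\<bar> \<le> rate ^ k * (\<integral>y. W y \<partial>\<mu>)"
    using integral_invariant[OF mu inv g, of k] integrable_dominated[OF mu Pk] by (simp add: mu.prob_space)
  with c[of x] have "\<bar>(P ^^ k) g x - (\<integral>y. g y \<partial>\<mu>)\<bar> \<le> rate ^ k * (W x + (\<integral>y. W y \<partial>\<mu>))"
    by (simp add: algebra_simps)
  then have "\<beta> * \<bar>(\<integral>y. f y \<partial>iter x k) - (\<integral>y. f y \<partial>\<mu>)\<bar> \<le> rate ^ k * (W x + (\<integral>y. W y \<partial>\<mu>))"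
    using beta by (simp add: integral_iter[OF g, symmetric] g_def abs_mult flip: right_diff_distrib)
  then show ?thesis using beta by (simp add: pos_le_divide_eq mult.commute)
qed

end

section \<open>The kernel of the Metropolis-adjusted Langevin algorithm\<close>

lemma nn_integral_gaussian_real:
  fixes a c :: real assumes c: "0 < c"
  shows "(\<integral>\<^sup>+x. ennreal (exp (- (c * (x - a)\<^sup>2))) \<partial>lborel) = ennreal (sqrt (pi / c))"
proof -
  \<comment> \<open>The integrand is a multiple of the normal density with variance
    \<open>1 / (2 * c)\<close>.\<close>
  define s where "s = sqrt (1 / (2 * c))"
  have s: "0 < s" "s\<^sup>2 = 1 / (2 * c)" using c by (auto simp: s_def)
  have *: "exp (- (c * (x - a)\<^sup>2)) = sqrt (pi / c) * normal_density a s x" for x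
    using c by (simp add: normal_density_def s(2) mult.commute)
  interpret prob_space "density lborel (normal_density a s)" by (rule prob_space_normal_density[OF s(1)])
  have "(\<integral>\<^sup>+x. ennreal (normal_density a s x) \<partial>lborel) = 1"
    using emeasure_space_1 by (simp add: emeasure_density)
  then show ?thesis
    unfolding * using c s(1) by (simp add: ennreal_mult nn_integral_cmult)
qed

text \<open>The squared norm splits over \<open>Basis\<close>, so the integral is a product of
  one-dimensional ones.\<close>

lemma nn_integral_gaussian:
  fixes a :: "'a::euclidean_space" assumes c: "0 < c"
  shows "(\<integral>\<^sup>+x. ennreal (exp (- c * (norm (x - a))\<^sup>2)) \<partial>lborel) = ennreal ((pi / c) powr (DIM('a) / 2))"
proof -
  have "exp (- c * (norm (x - a))\<^sup>2) = (\<Prod>b\<in>Basis. exp (- c * (x \<bullet> b - a \<bullet> b)\<^sup>2))" for x :: 'a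
  proof -
    have "(norm (x - a))\<^sup>2 = (\<Sum>b\<in>Basis. (x \<bullet> b - a \<bullet> b)\<^sup>2)"
      by (subst power2_norm_eq_inner, subst euclidean_inner) (simp add: inner_diff_left power2_eq_square)
    then show ?thesis by (simp add: sum_distrib_left exp_sum flip: sum_negf)
  qed
  then have "(\<integral>\<^sup>+x. ennreal (exp (- c * (norm (x - a))\<^sup>2)) \<partial>lborel)
      = (\<integral>\<^sup>+x. (\<Prod>b\<in>Basis. ennreal (exp (- c * (x \<bullet> b - a \<bullet> b)\<^sup>2))) \<partial>(lborel :: 'a measure))"
    by (simp add: prod_ennreal)
  also have "\<dots> = (\<Prod>b\<in>(Basis::'a set). ennreal (sqrt (pi / c)))"
    using c by (subst nn_integral_lborel_prod[where f="\<lambda>b x. ennreal (exp (- c * (x - a \<bullet> b)\<^sup>2))"])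
      (auto simp: nn_integral_gaussian_real)
  also have "\<dots> = ennreal ((pi / c) powr (DIM('a) / 2))"
    using c by (simp add: ennreal_power powr_half_sqrt[symmetric] powr_power)
  finally show ?thesis .
qed

text \<open>Serves for \<open>K x\<close>, which is an absolutely continuous part plus a weighted
  point mass. The decomposition passes from sets to functions by induction over nonnegative
  measurable functions.\<close>

lemma nn_integral_add_measure:
  assumes sets: "sets N1 = sets M" "sets N2 = sets M"
    and em: "\<And>A. A \<in> sets M \<Longrightarrow> emeasure M A = emeasure N1 A + c * emeasure N2 A"
    and f: "f \<in> borel_measurable M"
  shows "(\<integral>\<^sup>+x. f x \<partial>M) = (\<integral>\<^sup>+x. f x \<partial>N1) + c * (\<integral>\<^sup>+x. f x \<partial>N2)"
  using f
proof induction
  case (cong f g)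
  have sp: "space N1 = space M" "space N2 = space M" using sets sets_eq_imp_space_eq by blast+
  have "integral\<^sup>N M f = integral\<^sup>N M g" "integral\<^sup>N N1 f = integral\<^sup>N N1 g" "integral\<^sup>N N2 f = integral\<^sup>N N2 g"
    using cong(3) by (auto intro!: nn_integral_cong simp: sp)
  then show ?case using cong(4) by simp
next
  case (set A)
  then show ?case using sets em by simp
next
  case (mult u v)
  have "u \<in> borel_measurable N1" "u \<in> borel_measurable N2"
    using mult(2) sets by (simp_all cong: measurable_cong_sets)
  then show ?case using mult by (simp add: nn_integral_cmult distrib_left mult.left_commute)
next
  case (add u v)
  have "u \<in> borel_measurable N1" "u \<in> borel_measurable N2" "v \<in> borel_measurable N1" "v \<in> borel_measurable N2"
    using add(1,3) sets by (simp_all cong: measurable_cong_sets)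
  then show ?case using add by (simp add: nn_integral_add distrib_left ac_simps)
next
  case (seq F)
  have m: "\<And>i. F i \<in> borel_measurable N1" "\<And>i. F i \<in> borel_measurable N2"
    using seq(1) sets by (simp_all cong: measurable_cong_sets)
  have inc: "incseq (\<lambda>i. integral\<^sup>N N (F i))" for N
    using seq(3) by (auto simp: incseq_def le_fun_def intro!: nn_integral_mono)
  have SUP: "(\<integral>\<^sup>+x. (SUP i. F i) x \<partial>N) = (SUP i. integral\<^sup>N N (F i))" if "\<And>i. F i \<in> borel_measurable N" for N
    unfolding SUP_apply using seq(3) that by (intro nn_integral_monotone_convergence_SUP) auto
  have "(SUP i. integral\<^sup>N N1 (F i) + c * integral\<^sup>N N2 (F i))
      = (SUP i. integral\<^sup>N N1 (F i)) + (SUP i. c * integral\<^sup>N N2 (F i))"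
    using inc by (intro ennreal_SUP_add) (auto simp: incseq_def intro!: mult_left_mono)
  then show ?case
    using seq SUP m by (simp add: SUP_mult_left_ennreal)
qed

section \<open>Density, atom and invariant law of the kernel\<close>

locale mala =
  fixes U :: "'a::euclidean_space \<Rightarrow> real" and G :: "'a \<Rightarrow> 'a" and \<gamma> :: real
  assumes U_cont: "continuous_on UNIV U" and G_cont: "continuous_on UNIV G"
    and gamma: "0 < \<gamma>" and integ: "integrable lborel (\<lambda>y. exp (- U y))"
begin

abbreviation r :: "'a \<Rightarrow> 'a \<Rightarrow> real" where "r \<equiv> prop_dens G \<gamma>"
abbreviation \<alpha> :: "'a \<Rightarrow> 'a \<Rightarrow> real" where "\<alpha> \<equiv> acc_prob U G \<gamma>"
abbreviation K :: "'a \<Rightarrow> 'a measure" where "K \<equiv> mala_kernel U G \<gamma>"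

text \<open>\<open>q x\<close> is the density of the absolutely continuous part of
  \<open>K x\<close>, and \<open>rej x\<close> the mass of its atom at \<open>x\<close>.\<close>

definition q :: "'a \<Rightarrow> 'a \<Rightarrow> real" where "q x y = \<alpha> x y * r x y"
definition rej :: "'a \<Rightarrow> real" where "rej x = (\<integral>y. (1 - \<alpha> x y) * r x y \<partial>lborel)"

lemma U_measurable [measurable]: "U \<in> borel_measurable borel"
  using U_cont by (rule borel_measurable_continuous_onI)

lemma G_measurable [measurable]: "G \<in> borel_measurable borel"
  using G_cont by (rule borel_measurable_continuous_onI)

lemma Zc_pos: "0 < Zc U"
proof -
  have "0 \<le> Zc U" unfolding Zc_def by (intro Bochner_Integration.integral_nonneg) auto
  moreover have "Zc U \<noteq> 0"
  proof
    assume "Zc U = 0"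
    then have "AE y in lborel. exp (- U y) = 0"
      using integral_nonneg_eq_0_iff_AE[OF integ] by (simp add: Zc_def)
    then have "AE y in (lborel::'a measure). False" by simp
    then show False by (simp add: eventually_False ae_filter_eq_bot_iff)
  qed
  ultimately show ?thesis by simp
qed

lemma pi_pos: "0 < pi_dens U x"
  using Zc_pos by (simp add: pi_dens_def)

lemma r_pos: "0 < r x y"
  using gamma by (simp add: prop_dens_def)

lemma r_eq: "r x y = (4 * pi * \<gamma>) powr (- real DIM('a) / 2) * exp (- (1 / (4 * \<gamma>)) * (norm (y - (x - \<gamma> *\<^sub>R G x)))\<^sup>2)"
  by (simp add: prop_dens_def algebra_simps)

lemma measurable_r [measurable]: "(\<lambda>z. r (fst z) (snd z)) \<in> borel_measurable (borel \<Otimes>\<^sub>M borel)"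
  unfolding prop_dens_def by measurable

lemma measurable_r_flip [measurable]: "(\<lambda>z. r (snd z) (fst z)) \<in> borel_measurable (borel \<Otimes>\<^sub>M borel)"
  unfolding prop_dens_def by measurable

lemma measurable_pi [measurable]: "pi_dens U \<in> borel_measurable borel"
  unfolding pi_dens_def[abs_def] by measurable

lemma measurable_acc [measurable]: "(\<lambda>z. \<alpha> (fst z) (snd z)) \<in> borel_measurable (borel \<Otimes>\<^sub>M borel)"
  unfolding acc_prob_def by measurable

lemma measurable_q [measurable]: "(\<lambda>z. q (fst z) (snd z)) \<in> borel_measurable (borel \<Otimes>\<^sub>M borel)"
  unfolding q_def by measurable

lemma measurable_section [measurable]:
  "r x \<in> borel_measurable borel" "q x \<in> borel_measurable borel" "\<alpha> x \<in> borel_measurable borel"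
  using measurable_compose[OF measurable_Pair1' measurable_r, of x]
    measurable_compose[OF measurable_Pair1' measurable_q, of x]
    measurable_compose[OF measurable_Pair1' measurable_acc, of x]
  by simp_all

lemma nn_integral_r: "(\<integral>\<^sup>+y. ennreal (r x y) \<partial>lborel) = 1"
proof -
  have "(\<integral>\<^sup>+y. ennreal (r x y) \<partial>lborel)
     = ennreal ((4 * pi * \<gamma>) powr (- real DIM('a) / 2)) * ennreal ((pi / (1 / (4 * \<gamma>))) powr (DIM('a) / 2))"
    unfolding r_eq using gamma
    by (subst nn_integral_gaussian[symmetric]) (auto simp: ennreal_mult' nn_integral_cmult)
  also have "\<dots> = 1"
    using gamma by (simp add: ennreal_mult[symmetric] powr_add[symmetric] mult_ac)
  finally show ?thesis .
qed

lemma integrable_r: "integrable lborel (r x)"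
  using nn_integral_r[of x] r_pos[of x] by (intro integrableI_nonneg) (auto simp: less_imp_le)

lemma integral_r: "(\<integral>y. r x y \<partial>lborel) = 1"
  using nn_integral_r[of x] r_pos[of x] by (subst integral_eq_nn_integral) (auto simp: less_imp_le)

lemma acc_bounds: "0 < \<alpha> x y" "\<alpha> x y \<le> 1"
  using pi_pos r_pos by (auto simp: acc_prob_def)

lemma q_bounds: "0 < q x y" "q x y \<le> r x y"
  using acc_bounds[of x y] r_pos[of x y] by (auto simp: q_def)

lemma integrable_q: "integrable lborel (q x)"
  using q_bounds[of x] r_pos[of x]
  by (intro Bochner_Integration.integrable_bound[OF integrable_r[of x]]) (auto simp: less_imp_le abs_of_pos)

lemma rej_eq: "rej x = 1 - (\<integral>y. q x y \<partial>lborel)"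
proof -
  have "rej x = (\<integral>y. r x y - q x y \<partial>lborel)" by (simp add: rej_def q_def left_diff_distrib)
  then show ?thesis using integrable_q integrable_r integral_r by simp
qed

lemma rej_nonneg: "0 \<le> rej x"
  unfolding rej_def using acc_bounds r_pos
  by (intro Bochner_Integration.integral_nonneg) (auto simp: less_imp_le)

lemma measurable_rej [measurable]: "rej \<in> borel_measurable borel"
  unfolding rej_eq[abs_def] using measurable_q
  by (intro borel_measurable_diff borel_measurable_const lborel.borel_measurable_lebesgue_integral)
    (simp add: split_beta')

lemma acc_plus_rej: "(\<integral>\<^sup>+y. ennreal (q x y) \<partial>lborel) + ennreal (rej x) = 1"
proof -
  have "0 \<le> (\<integral>y. q x y \<partial>lborel)" using q_bounds by (intro Bochner_Integration.integral_nonneg) (auto simp: less_imp_le)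
  moreover have "(\<integral>\<^sup>+y. ennreal (q x y) \<partial>lborel) = ennreal (\<integral>y. q x y \<partial>lborel)"
    using integrable_q q_bounds by (intro nn_integral_eq_integral) (auto simp: less_imp_le)
  ultimately show ?thesis
    using rej_nonneg[of x] by (simp add: ennreal_plus[symmetric] rej_eq del: ennreal_plus)
qed

lemma sets_K [simp, measurable_cong]: "sets (K x) = sets borel"
  using sets.sigma_sets_eq[of "borel::'a measure"] by (simp add: mala_kernel_def)

lemma space_K [simp]: "space (K x) = UNIV"
  by (simp add: mala_kernel_def)

text \<open>\<open>mala_kernel\<close> is built by \<open>measure_of\<close>, so its set function
  must first be shown countably additive. On Borel sets it agrees with a density measure plus a
  weighted point mass and inherits additivity from them.\<close>

lemma emeasure_K:
  assumes A: "A \<in> sets borel"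
  shows "emeasure (K x) A = emeasure (density lborel (\<lambda>y. ennreal (q x y))) A
      + ennreal (rej x) * emeasure (return borel x) A" (is "_ = ?\<mu> A")
proof -
  let ?f = "\<lambda>A. ennreal ((\<integral>y. indicator A y * \<alpha> x y * r x y \<partial>lborel)
        + indicator A x * (\<integral>y. (1 - \<alpha> x y) * r x y \<partial>lborel))"
  have eq: "?f A = ?\<mu> A" if [measurable]: "A \<in> sets borel" for A
  proof -
    have "integrable lborel (\<lambda>y. indicator A y * q x y)"
      using integrable_mult_indicator[OF _ integrable_q, of A x] by simp
    then have "emeasure (density lborel (\<lambda>y. ennreal (q x y))) A = ennreal (\<integral>y. indicator A y * q x y \<partial>lborel)"
      using q_bounds
      by (subst emeasure_density)
        (auto simp: less_imp_le ennreal_mult'[symmetric] mult.commute nn_integral_eq_integral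
          ennreal_indicator[symmetric] simp del: ennreal_indicator)
    moreover have "0 \<le> (\<integral>y. indicator A y * q x y \<partial>lborel)"
      using q_bounds by (intro Bochner_Integration.integral_nonneg) (auto simp: less_imp_le)
    ultimately show ?thesis
      using rej_nonneg[of x] that
      by (auto simp: ennreal_plus q_def rej_def[symmetric] mult.assoc split: split_indicator)
  qed
  have "emeasure (K x) A = ?f A"
    unfolding mala_kernel_def
  proof (rule emeasure_measure_of_sigma)
    show "sigma_algebra UNIV (sets (borel::'a measure))"
      using sets.sigma_algebra_axioms[of borel] by simp
    show "positive (sets borel) ?f" by (simp add: positive_def)
    show "countably_additive (sets borel) ?f"
    proof (rule countably_additiveI)
      fix F :: "nat \<Rightarrow> 'a set" assume F: "range F \<subseteq> sets borel" "disjoint_family F" "\<Union> (range F) \<in> sets borel"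
      have "(\<Sum>i. ?f (F i)) = (\<Sum>i. ?\<mu> (F i))" using F(1) by (intro suminf_cong eq) auto
      also have "\<dots> = (\<Sum>i. emeasure (density lborel (\<lambda>y. ennreal (q x y))) (F i))
          + ennreal (rej x) * (\<Sum>i. emeasure (return borel x) (F i))"
        by (simp add: suminf_add[symmetric] ennreal_suminf_cmult)
      also have "\<dots> = ?\<mu> (\<Union> (range F))"
        using F suminf_emeasure[of F "return borel x"] by (simp add: suminf_emeasure del: emeasure_return)
      finally show "(\<Sum>i. ?f (F i)) = ?f (\<Union> (range F))" using eq[OF F(3)] by simp
    qed
  qed (fact A)
  with eq[OF A] show ?thesis by simp
qed

lemma nn_integral_K:
  assumes [measurable]: "g \<in> borel_measurable borel"
  shows "(\<integral>\<^sup>+y. g y \<partial>K x) = (\<integral>\<^sup>+y. ennreal (q x y) * g y \<partial>lborel) + ennreal (rej x) * g x"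
proof -
  have "(\<integral>\<^sup>+y. g y \<partial>K x) = (\<integral>\<^sup>+y. g y \<partial>density lborel (\<lambda>y. ennreal (q x y)))
      + ennreal (rej x) * (\<integral>\<^sup>+y. g y \<partial>return borel x)"
    by (rule nn_integral_add_measure) (simp_all add: emeasure_K)
  then show ?thesis by (simp add: nn_integral_density nn_integral_return)
qed

lemma prob_space_K: "prob_space (K x)"
  using nn_integral_K[of "\<lambda>_. 1" x] acc_plus_rej[of x] by (intro prob_spaceI) simp

lemma K_measurable [measurable]: "K \<in> borel \<rightarrow>\<^sub>M prob_algebra borel"
proof (intro measurable_prob_algebraI measurable_subprob_algebra)
  fix A :: "'a set" assume [measurable]: "A \<in> sets borel"
  have "(\<lambda>x. \<integral>\<^sup>+y. ennreal (q x y) * indicator A y \<partial>lborel) \<in> borel_measurable borel"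
    by (intro lborel.borel_measurable_nn_integral) (simp add: split_beta')
  then show "(\<lambda>x. emeasure (K x) A) \<in> borel_measurable borel"
    by (simp add: nn_integral_K flip: nn_integral_indicator)
qed (auto intro: prob_space_K prob_space_imp_subprob_space)

text \<open>Both sides are the minimum of \<open>pi_dens U x * r x y\<close> and
  \<open>pi_dens U y * r y x\<close>, which is symmetric.\<close>

lemma detailed_balance: "pi_dens U x * q x y = pi_dens U y * q y x"
proof -
  have "pi_dens U x * q x y = min (pi_dens U x * r x y) (pi_dens U y * r y x)" for x y
    using pi_pos[of x] r_pos[of x y] by (simp add: q_def acc_prob_def min_def field_simps)
  then show ?thesis by (simp add: min.commute)
qed

lemma sets_pi [simp, measurable_cong]: "sets (pi_meas U) = sets borel"
  by (simp add: pi_meas_def)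

lemma space_pi [simp]: "space (pi_meas U) = UNIV"
  by (simp add: pi_meas_def)

lemma prob_space_pi: "prob_space (pi_meas U)"
proof (intro prob_spaceI)
  have "(\<integral>\<^sup>+y. ennreal (pi_dens U y) \<partial>lborel) = ennreal (\<integral>y. pi_dens U y \<partial>lborel)"
    using integ pi_pos by (intro nn_integral_eq_integral) (auto simp: pi_dens_def[abs_def] less_imp_le)
  also have "(\<integral>y. pi_dens U y \<partial>lborel) = 1"
    using Zc_pos by (simp add: pi_dens_def[abs_def] Zc_def)
  finally show "emeasure (pi_meas U) (space (pi_meas U)) = 1"
    by (simp add: pi_meas_def emeasure_density)
qed

text \<open>After exchanging the integrals, detailed balance turns the accepted flow into
  \<open>A\<close> into the accepted flow starting in \<open>A\<close>; with the rejected part this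
  is the whole mass of \<open>A\<close>.\<close>

lemma pi_invariant: "pi_meas U \<bind> K = pi_meas U"
proof (rule measure_eqI)
  have in_alg: "pi_meas U \<in> space (prob_algebra borel)"
    using prob_space_pi by (simp add: space_prob_algebra)
  show sets: "sets (pi_meas U \<bind> K) = sets (pi_meas U)"
    using sets_bind'[OF in_alg K_measurable] by simp
  fix A assume "A \<in> sets (pi_meas U \<bind> K)"
  then have A [measurable]: "A \<in> sets borel" using sets by simp
  let ?p = "\<lambda>x. ennreal (pi_dens U x)" and ?q = "\<lambda>x y. ennreal (q x y)"
  have [measurable]: "(\<lambda>x. \<integral>\<^sup>+y. ennreal (q x y) * indicator A y \<partial>lborel) \<in> borel_measurable borel"
    by (intro lborel.borel_measurable_nn_integral) (simp add: split_beta')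
  have [measurable]: "(\<lambda>z. q (snd z) (fst z)) \<in> borel_measurable (borel \<Otimes>\<^sub>M borel)"
    using measurable_compose[OF measurable_pair_swap' measurable_q] by (simp add: split_beta')
  have "emeasure (pi_meas U \<bind> K) A = (\<integral>\<^sup>+x. emeasure (K x) A \<partial>pi_meas U)"
    by (rule emeasure_bind_prob_algebra[OF in_alg K_measurable A])
  also have "\<dots> = (\<integral>\<^sup>+x. ?p x * ((\<integral>\<^sup>+y. ?q x y * indicator A y \<partial>lborel) + ennreal (rej x) * indicator A x) \<partial>lborel)"
    unfolding pi_meas_def by (subst nn_integral_density) (simp_all add: nn_integral_K flip: nn_integral_indicator)
  also have "\<dots> = (\<integral>\<^sup>+x. (\<integral>\<^sup>+y. ?p x * ?q x y * indicator A y \<partial>lborel) \<partial>lborel)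
      + (\<integral>\<^sup>+x. ?p x * ennreal (rej x) * indicator A x \<partial>lborel)"
    by (simp add: distrib_left nn_integral_add nn_integral_cmult mult.assoc)
  also have "(\<integral>\<^sup>+x. (\<integral>\<^sup>+y. ?p x * ?q x y * indicator A y \<partial>lborel) \<partial>lborel)
      = (\<integral>\<^sup>+y. (\<integral>\<^sup>+x. ?p x * ?q x y * indicator A y \<partial>lborel) \<partial>lborel)"
    by (rule lborel_pair.Fubini') (simp add: split_beta')
  also have "\<dots> = (\<integral>\<^sup>+y. (\<integral>\<^sup>+x. ?p y * indicator A y * ?q y x \<partial>lborel) \<partial>lborel)"
  proof (intro nn_integral_cong)
    fix x y
    have "?p x * ?q x y = ?p y * ?q y x"
      using detailed_balance[of x y] pi_pos q_bounds(1) by (simp add: ennreal_mult[symmetric] less_imp_le)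
    then show "?p x * ?q x y * indicator A y = ?p y * indicator A y * ?q y x" by (simp add: mult_ac)
  qed
  also have "\<dots> = (\<integral>\<^sup>+y. ?p y * indicator A y * (\<integral>\<^sup>+x. ?q y x \<partial>lborel) \<partial>lborel)"
    by (simp add: nn_integral_cmult)
  also have "\<dots> + (\<integral>\<^sup>+x. ?p x * ennreal (rej x) * indicator A x \<partial>lborel)
      = (\<integral>\<^sup>+y. ?p y * indicator A y * ((\<integral>\<^sup>+x. ?q y x \<partial>lborel) + ennreal (rej y)) \<partial>lborel)"
  proof -
    have [measurable]: "(\<lambda>y. \<integral>\<^sup>+x. ?q y x \<partial>lborel) \<in> borel_measurable borel"
      by (intro lborel.borel_measurable_nn_integral) (simp add: split_beta')
    show ?thesis by (subst nn_integral_add[symmetric]) (auto simp: distrib_left mult_ac)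
  qed
  also have "\<dots> = emeasure (pi_meas U) A"
    by (simp add: acc_plus_rej pi_meas_def emeasure_density)
  finally show "emeasure (pi_meas U \<bind> K) A = emeasure (pi_meas U) A" .
qed

lemma continuous_q: "continuous_on UNIV (\<lambda>z. q (fst z) (snd z))"
proof -
  have G: "continuous_on UNIV (\<lambda>z. G (f z))" and U: "continuous_on UNIV (\<lambda>z. U (f z))"
    if "continuous_on UNIV f" for f :: "'a \<times> 'a \<Rightarrow> 'a"
    using that continuous_on_compose2[OF G_cont] continuous_on_compose2[OF U_cont] by auto
  have "r a b \<noteq> 0" "pi_dens U a \<noteq> 0" for a b using r_pos[of a b] pi_pos[of a] by auto
  moreover have r: "continuous_on UNIV (\<lambda>z. r (f z) (g z))"
    if "continuous_on UNIV f" "continuous_on UNIV g" for f g :: "'a \<times> 'a \<Rightarrow> 'a"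
    unfolding prop_dens_def using that gamma by (intro continuous_intros G) auto
  moreover have p: "continuous_on UNIV (\<lambda>z. pi_dens U (f z))"
    if "continuous_on UNIV f" for f :: "'a \<times> 'a \<Rightarrow> 'a"
    unfolding pi_dens_def using that Zc_pos by (intro continuous_intros U) auto
  ultimately show ?thesis
    unfolding q_def acc_prob_def by (intro continuous_intros r p) auto
qed

text \<open>The positive continuous \<open>q\<close> attains a positive minimum on the compact
  product of \<open>cball 0 R\<close> and the unit ball. This minimum times the volume of the unit
  ball is \<open>\<epsilon>\<close>.\<close>

lemma minorization:
  "\<exists>\<epsilon>>0. \<forall>x g. norm x \<le> R \<longrightarrow> g \<in> borel_measurable borel \<longrightarrow>
     ennreal \<epsilon> * (\<integral>\<^sup>+y. g y \<partial>uniform_measure lborel (cball 0 1)) \<le> (\<integral>\<^sup>+y. g y \<partial>K x)"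
proof (cases "0 \<le> R")
  case False
  then have "\<not> norm x \<le> R" for x :: 'a by (smt (verit) norm_ge_zero)
  then show ?thesis by (intro exI[of _ 1]) simp
next
  case True
  let ?B = "cball 0 1 :: 'a set"
  have [measurable]: "?B \<in> sets borel" by (intro borel_closed closed_cball)
  have "compact ((cball 0 R :: 'a set) \<times> ?B)" "(cball 0 R :: 'a set) \<times> ?B \<noteq> {}" using True by (auto intro!: compact_Times compact_cball)
  from continuous_attains_inf[OF this continuous_on_subset[OF continuous_q subset_UNIV]]
  obtain z where z: "\<And>w. w \<in> cball 0 R \<times> ?B \<Longrightarrow> q (fst z) (snd z) \<le> q (fst w) (snd w)" by blast
  define x0 y0 where "x0 = fst z" and "y0 = snd z"
  have le: "q x0 y0 \<le> q x y" if "norm x \<le> R" "norm y \<le> 1" for x y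
    using z[of "(x, y)"] that by (simp add: x0_def y0_def)
  define v where "v = measure lborel ?B"
  have fin: "emeasure lborel ?B < \<infinity>" by (rule emeasure_lborel_cball_finite)
  have v: "emeasure lborel ?B = ennreal v" "0 < v"
    using fin content_cball_pos[of 1 0] by (auto simp: v_def emeasure_eq_ennreal_measure)
  show ?thesis
  proof (intro exI[of _ "q x0 y0 * v"] conjI allI impI)
    show "0 < q x0 y0 * v" using q_bounds(1) v by simp
    fix x :: 'a and g :: "'a \<Rightarrow> ennreal"
    assume x: "norm x \<le> R" and [measurable]: "g \<in> borel_measurable borel"
    have "ennreal (q x0 y0 * v) * (\<integral>\<^sup>+y. g y \<partial>uniform_measure lborel ?B)
        = ennreal (q x0 y0) * (ennreal v * ((\<integral>\<^sup>+y. g y * indicator ?B y \<partial>lborel) / ennreal v))"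
      using q_bounds(1)[of x0 y0] v by (subst nn_integral_uniform_measure) (auto simp: ennreal_mult less_imp_le mult.assoc)
    also have "\<dots> = ennreal (q x0 y0) * (\<integral>\<^sup>+y. g y * indicator ?B y \<partial>lborel)"
      using v by (simp add: ennreal_times_divide mult_divide_eq_ennreal mult.commute[of "ennreal v"])
    also have "\<dots> = (\<integral>\<^sup>+y. ennreal (q x0 y0) * (g y * indicator ?B y) \<partial>lborel)"
      by (rule nn_integral_cmult[symmetric]) measurable
    also have "\<dots> \<le> (\<integral>\<^sup>+y. ennreal (q x y) * g y \<partial>lborel)"
      using le[OF x] by (intro nn_integral_mono) (auto split: split_indicator intro!: mult_right_mono ennreal_leI)
    also have "\<dots> \<le> (\<integral>\<^sup>+y. g y \<partial>K x)" by (simp add: nn_integral_K)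
    finally show "ennreal (q x0 y0 * v) * (\<integral>\<^sup>+y. g y \<partial>uniform_measure lborel ?B) \<le> (\<integral>\<^sup>+y. g y \<partial>K x)" .
  qed
qed

end

section \<open>Potentials that are strongly convex outside a ball\<close>

locale potential =
  fixes U :: "'a::euclidean_space \<Rightarrow> real" and G :: "'a \<Rightarrow> 'a" and H :: "'a \<Rightarrow> 'a \<Rightarrow>\<^sub>L 'a"
    and L m \<kappa> :: real
  assumes grad: "\<And>x. (U has_derivative (\<lambda>h. G x \<bullet> h)) (at x)"
    and hess: "\<And>x. (G has_derivative blinfun_apply (H x)) (at x)"
    and grad0: "G 0 = 0"
    and L: "\<And>x. norm (H x) \<le> L"
    and m: "m > 0" and kappa: "\<kappa> \<ge> 0"
    and convex_out: "\<And>x y. norm x \<ge> \<kappa> \<Longrightarrow> norm y = 1 \<Longrightarrow> blinfun_apply (H x) y \<bullet> y \<ge> m"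
begin

text \<open>The price of the ball of radius \<open>\<kappa>\<close>, where convexity may fail: the
  coefficient of the linear error in \<open>coercive\<close> and \<open>U_growth\<close>.\<close>

definition C :: real where "C = (m + L) * \<kappa>"

text \<open>At a point of norm \<open>\<kappa>\<close> both bounds on the Hessian apply to a unit
  vector.\<close>

lemma m_le_L: "m \<le> L"
proof -
  obtain e :: 'a where e: "norm e = 1" using norm_Basis SOME_Basis by blast
  have "m \<le> blinfun_apply (H (\<kappa> *\<^sub>R e)) e \<bullet> e"
    using convex_out[of "\<kappa> *\<^sub>R e" e] e kappa by simp
  also have "\<dots> \<le> norm (blinfun_apply (H (\<kappa> *\<^sub>R e)) e) * norm e" by (rule norm_cauchy_schwarz)
  also have "\<dots> \<le> norm (H (\<kappa> *\<^sub>R e))" using norm_blinfun[of "H (\<kappa> *\<^sub>R e)" e] e by simp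
  also have "\<dots> \<le> L" by (rule L)
  finally show ?thesis .
qed

lemma L_pos: "0 < L"
  using m m_le_L by simp

lemma C_nonneg: "0 \<le> C"
  using m L_pos kappa by (simp add: C_def)

lemma G_lipschitz: "norm (G x - G y) \<le> L * norm (x - y)"
  by (rule differentiable_bound[of UNIV G "\<lambda>x. blinfun_apply (H x)"])
    (use hess L in \<open>auto simp: norm_blinfun.rep_eq\<close>)

lemma norm_G_le: "norm (G x) \<le> L * norm x"
  using G_lipschitz[of x 0] grad0 by simp

lemma hess_lower:
  assumes "\<kappa> \<le> norm x" shows "m * (norm v)\<^sup>2 \<le> blinfun_apply (H x) v \<bullet> v"
proof (cases "v = 0")
  case False
  then have "m \<le> blinfun_apply (H x) (v /\<^sub>R norm v) \<bullet> (v /\<^sub>R norm v)"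
    using assms by (intro convex_out) auto
  also have "\<dots> = (blinfun_apply (H x) v \<bullet> v) / (norm v)\<^sup>2"
    by (simp add: blinfun.scaleR_right power2_eq_square field_simps)
  finally show ?thesis using False by (simp add: field_simps)
qed simp

context
  fixes y h :: 'a
  assumes seg: "\<And>t. 0 \<le> t \<Longrightarrow> t \<le> 1 \<Longrightarrow> \<kappa> \<le> norm (y + t *\<^sub>R h)"
begin

text \<open>The derivative of \<open>G (y + s *\<^sub>R h) \<bullet> h\<close> in \<open>s\<close>
  is at least \<open>m * (norm h)\<^sup>2\<close> as long as the segment stays outside the ball. The
  outside need not be convex, so \<open>seg\<close> concerns the whole segment and not only its
  ends.\<close>

lemma G_segment_ge:
  assumes t: "0 \<le> t" "t \<le> 1"
  shows "G y \<bullet> h + m * t * (norm h)\<^sup>2 \<le> G (y + t *\<^sub>R h) \<bullet> h"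
proof -
  define f where "f s = G (y + s *\<^sub>R h) \<bullet> h - m * s * (norm h)\<^sup>2" for s
  have "f 0 \<le> f t"
  proof (rule DERIV_nonneg_imp_nondecreasing[OF t(1)])
    fix s assume s: "0 \<le> s" "s \<le> t"
    have "((\<lambda>s. G (y + s *\<^sub>R h)) has_derivative (\<lambda>d. blinfun_apply (H (y + s *\<^sub>R h)) (d *\<^sub>R h))) (at s)"
      by (rule has_derivative_compose[OF _ hess]) (auto intro!: derivative_eq_intros)
    then have "(f has_real_derivative (blinfun_apply (H (y + s *\<^sub>R h)) h \<bullet> h - m * (norm h)\<^sup>2)) (at s)"
      unfolding f_def[abs_def] has_field_derivative_def
      by (auto intro!: derivative_eq_intros simp: blinfun.scaleR_right algebra_simps)
    moreover have "m * (norm h)\<^sup>2 \<le> blinfun_apply (H (y + s *\<^sub>R h)) h \<bullet> h"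
      using s t by (intro hess_lower seg) auto
    ultimately show "\<exists>z. (f has_real_derivative z) (at s) \<and> 0 \<le> z" by (auto intro: exI[of _ "_ - _"])
  qed
  then show ?thesis by (simp add: f_def)
qed

text \<open>The previous bound integrated over \<open>t\<close>, in the form of a monotone auxiliary
  function.\<close>

lemma U_segment_ge: "U y + G y \<bullet> h + m / 2 * (norm h)\<^sup>2 \<le> U (y + h)"
proof -
  define f where "f s = U (y + s *\<^sub>R h) - s * (G y \<bullet> h) - m / 2 * s\<^sup>2 * (norm h)\<^sup>2" for s
  have "f 0 \<le> f 1"
  proof (rule DERIV_nonneg_imp_nondecreasing[of 0 1 f])
    fix s :: real assume s: "0 \<le> s" "s \<le> 1"
    have "((\<lambda>s. U (y + s *\<^sub>R h)) has_derivative (\<lambda>d. G (y + s *\<^sub>R h) \<bullet> (d *\<^sub>R h))) (at s)"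
      by (rule has_derivative_compose[OF _ grad]) (auto intro!: derivative_eq_intros)
    then have "(f has_real_derivative (G (y + s *\<^sub>R h) \<bullet> h - G y \<bullet> h - m * s * (norm h)\<^sup>2)) (at s)"
      unfolding f_def[abs_def] has_field_derivative_def
      by (auto intro!: derivative_eq_intros simp: algebra_simps)
    then show "\<exists>z. (f has_real_derivative z) (at s) \<and> 0 \<le> z"
      using G_segment_ge[OF s] by (intro exI conjI) auto
  qed simp
  then show ?thesis by (simp add: f_def)
qed

end

text \<open>Inside the ball the Lipschitz bound on \<open>G\<close> suffices. Outside, strong
  convexity acts along the ray beyond the sphere of radius \<open>\<kappa>\<close>, and
  \<open>G\<close> at the crossing point is again controlled by \<open>L\<close>.\<close>

lemma coercive: "m * (norm x)\<^sup>2 - C * norm x \<le> G x \<bullet> x"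
proof (cases "norm x \<le> \<kappa>")
  case True
  have "\<bar>G x \<bullet> x\<bar> \<le> norm (G x) * norm x" by (rule Cauchy_Schwarz_ineq2)
  also have "\<dots> \<le> L * norm x * norm x" using norm_G_le by (intro mult_right_mono) auto
  finally have "- (L * (norm x)\<^sup>2) \<le> G x \<bullet> x" by (simp add: power2_eq_square)
  moreover have "(m + L) * norm x * norm x \<le> (m + L) * norm x * \<kappa>"
    using True m L_pos by (intro mult_left_mono) auto
  ultimately show ?thesis by (simp add: C_def power2_eq_square algebra_simps)
next
  case False
  \<comment> \<open>\<open>s *\<^sub>R x\<close> is where the segment from \<open>0\<close> to
    \<open>x\<close> leaves the ball of radius \<open>\<kappa>\<close>.\<close>
  define s where "s = \<kappa> / norm x"
  have x: "0 < norm x" using False kappa by linarith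
  have s: "0 \<le> s" "s < 1" "s * norm x = \<kappa>" using False kappa x by (auto simp: s_def)
  have "\<kappa> \<le> norm (s *\<^sub>R x + t *\<^sub>R ((1 - s) *\<^sub>R x))" if t: "0 \<le> t" for t
  proof -
    have "s *\<^sub>R x + t *\<^sub>R ((1 - s) *\<^sub>R x) = (s + t * (1 - s)) *\<^sub>R x" by (simp add: algebra_simps)
    moreover have "s * norm x \<le> (s + t * (1 - s)) * norm x" using s t by (intro mult_right_mono) auto
    ultimately show ?thesis using s t by simp
  qed
  from G_segment_ge[of "s *\<^sub>R x" "(1 - s) *\<^sub>R x" 1, OF this]
  have a: "G (s *\<^sub>R x) \<bullet> ((1 - s) *\<^sub>R x) + m * 1 * (norm ((1 - s) *\<^sub>R x))\<^sup>2
      \<le> G (s *\<^sub>R x + 1 *\<^sub>R ((1 - s) *\<^sub>R x)) \<bullet> ((1 - s) *\<^sub>R x)" by simp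
  have b: "s *\<^sub>R x + 1 *\<^sub>R ((1 - s) *\<^sub>R x) = x" by (simp add: algebra_simps)
  have c: "norm ((1 - s) *\<^sub>R x) = (1 - s) * norm x" using s by simp
  from a[unfolded b c inner_scaleR_right]
  have "(1 - s) * (G (s *\<^sub>R x) \<bullet> x + m * (1 - s) * (norm x)\<^sup>2) \<le> (1 - s) * (G x \<bullet> x)"
    by (simp add: power2_eq_square algebra_simps)
  then have *: "G (s *\<^sub>R x) \<bullet> x + m * (1 - s) * (norm x)\<^sup>2 \<le> G x \<bullet> x" using s by simp
  have "\<bar>G (s *\<^sub>R x) \<bullet> x\<bar> \<le> norm (G (s *\<^sub>R x)) * norm x" by (rule Cauchy_Schwarz_ineq2)
  also have "\<dots> \<le> L * \<kappa> * norm x" using norm_G_le[of "s *\<^sub>R x"] s by (intro mult_right_mono) auto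
  finally have "- (L * \<kappa> * norm x) \<le> G (s *\<^sub>R x) \<bullet> x" by linarith
  moreover have "m * (1 - s) * (norm x)\<^sup>2 = m * (norm x)\<^sup>2 - m * \<kappa> * norm x"
    using s(3) by (simp add: power2_eq_square algebra_simps)
  moreover have "C * norm x = m * \<kappa> * norm x + L * \<kappa> * norm x" by (simp add: C_def algebra_simps)
  ultimately show ?thesis using * by linarith
qed

lemma norm_G_ge: "m * norm x - C \<le> norm (G x)"
proof (cases "x = 0")
  case False
  have "(m * norm x - C) * norm x \<le> norm (G x) * norm x"
    using coercive[of x] norm_cauchy_schwarz[of "G x" x] by (simp add: power2_eq_square algebra_simps)
  then show ?thesis using False by simp
qed (use C_nonneg grad0 in simp)

text \<open>\<open>coercive\<close> is integrated along the ray from \<open>0\<close> to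
  \<open>x\<close>.\<close>

lemma U_growth: "U 0 + m / 2 * (norm x)\<^sup>2 - C * norm x \<le> U x"
proof -
  define f where "f s = U (s *\<^sub>R x) - m / 2 * s\<^sup>2 * (norm x)\<^sup>2 + s * (C * norm x)" for s
  have "f 0 \<le> f 1"
  proof (rule DERIV_nonneg_imp_nondecreasing[of 0 1 f])
    fix s :: real assume s: "0 \<le> s" "s \<le> 1"
    have "((\<lambda>s. U (s *\<^sub>R x)) has_derivative (\<lambda>d. G (s *\<^sub>R x) \<bullet> (d *\<^sub>R x))) (at s)"
      by (rule has_derivative_compose[OF _ grad]) (auto intro!: derivative_eq_intros)
    then have "(f has_real_derivative (G (s *\<^sub>R x) \<bullet> x - m * s * (norm x)\<^sup>2 + C * norm x)) (at s)"
      unfolding f_def[abs_def] has_field_derivative_def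
      by (auto intro!: derivative_eq_intros simp: algebra_simps)
    moreover have "0 \<le> G (s *\<^sub>R x) \<bullet> x - m * s * (norm x)\<^sup>2 + C * norm x"
    \<comment> \<open>\<open>coercive\<close> at \<open>s *\<^sub>R x\<close> is the wanted
      inequality times \<open>s\<close>; at \<open>s = 0\<close> the gradient vanishes
      instead.\<close>
    proof (cases "s = 0")
      case False
      have "s * (m * s * (norm x)\<^sup>2 - C * norm x) \<le> s * (G (s *\<^sub>R x) \<bullet> x)"
        using coercive[of "s *\<^sub>R x"] s by (simp add: power_mult_distrib power2_eq_square algebra_simps)
      then show ?thesis using False s by simp
    qed (use grad0 C_nonneg in simp)
    ultimately show "\<exists>z. (f has_real_derivative z) (at s) \<and> 0 \<le> z" by blast
  qed simp
  then show ?thesis by (simp add: f_def)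
qed

end

section \<open>Small step sizes: acceptance, drift and geometric ergodicity\<close>

locale mala_potential = potential U G H L m \<kappa>
  for U :: "'a::euclidean_space \<Rightarrow> real" and G H L m \<kappa> +
  fixes \<gamma> :: real
  assumes integrable_exp: "integrable lborel (\<lambda>y. exp (- U y))"
    and gamma_pos: "0 < \<gamma>" and gamma_small: "2 * \<gamma> * L\<^sup>2 \<le> m"
begin

sublocale mala U G \<gamma>
proof
  show "continuous_on UNIV U" "continuous_on UNIV G"
    using has_derivative_continuous[OF grad] has_derivative_continuous[OF hess]
    by (simp_all add: continuous_at_imp_continuous_on)
qed (rule gamma_pos integrable_exp)+

definition V :: "'a \<Rightarrow> real" where "V x = exp (m / 16 * (norm x)\<^sup>2)"

definition C0 :: real where "C0 = (4 * pi * \<gamma>) powr (- real DIM('a) / 2)"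

lemma C0_pos: "0 < C0"
  using gamma_pos by (simp add: C0_def)

lemma V_borel [measurable]: "V \<in> borel_measurable borel"
  unfolding V_def[abs_def] by measurable

text \<open>Makes the gradient step at most half as long as \<open>x\<close>; it follows from
  \<open>gamma_small\<close> and \<open>m \<le> L\<close>.\<close>

lemma gamma_L: "\<gamma> * L \<le> 1 / 2"
proof -
  have "(2 * \<gamma> * L) * L \<le> 1 * L" using gamma_small m_le_L by (simp add: power2_eq_square)
  then have "2 * \<gamma> * L \<le> 1" using L_pos by (simp only: mult_le_cancel_right_pos)
  then show ?thesis by simp
qed

lemma gamma_m: "\<gamma> * m \<le> 1 / 2"
  using gamma_L mult_left_mono[OF m_le_L less_imp_le[OF gamma_pos]] by linarith

text \<open>Here \<open>w\<close> is the Gaussian increment of the proposal. Written in terms of \<open>w\<close>, the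
  logarithm of the ratio contains \<open>U\<close> only through its Bregman divergence at \<open>y\<close>, which strong
  convexity bounds below by \<open>m / 2 * (norm (x - y))\<^sup>2\<close>; this beats the remaining terms.\<close>
lemma acc_ratio:
  assumes w: "w = y - x + \<gamma> *\<^sub>R G x" and D: "D = G y - G x"
  shows "(pi_dens U y * r y x) / (pi_dens U x * r x y)
     = exp (U x - U y - G y \<bullet> (x - y) - (D \<bullet> w) / 2 - \<gamma> / 4 * (norm D)\<^sup>2)"
proof -
  define h where "h = y - x"
  have Gx: "\<gamma> *\<^sub>R G x = w - h" by (simp add: w h_def)
  \<comment> \<open>The increment of the reverse proposal, from \<open>y\<close> to
    \<open>x\<close>, in terms of the forward one.\<close>
  have e: "x - y + \<gamma> *\<^sub>R G y = w - 2 *\<^sub>R h + \<gamma> *\<^sub>R D"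
    by (simp add: D h_def w algebra_simps scaleR_2)
  \<comment> \<open>With this the terms of the difference of squares that lack a factor
    \<open>\<gamma>\<close> combine to \<open>4 * \<gamma> * (h \<bullet> G y)\<close>, so no
    \<open>1 / \<gamma>\<close> survives.\<close>
  have hG: "\<gamma> * (h \<bullet> G y) = h \<bullet> w - h \<bullet> h + \<gamma> * (h \<bullet> D)"
  proof -
    have "\<gamma> * (h \<bullet> G y) = h \<bullet> (\<gamma> *\<^sub>R G x + \<gamma> *\<^sub>R D)" by (simp add: D inner_simps algebra_simps)
    then show ?thesis by (simp add: Gx inner_simps)
  qed
  have N: "(norm (w - 2 *\<^sub>R h + \<gamma> *\<^sub>R D))\<^sup>2
      = w \<bullet> w + 4 * (h \<bullet> h) + \<gamma>\<^sup>2 * (D \<bullet> D) - 4 * (h \<bullet> w) + 2 * \<gamma> * (D \<bullet> w) - 4 * \<gamma> * (h \<bullet> D)"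
    unfolding power2_norm_eq_inner
    by (simp add: inner_simps inner_commute power2_eq_square algebra_simps)
  have "((norm w)\<^sup>2 - (norm (w - 2 *\<^sub>R h + \<gamma> *\<^sub>R D))\<^sup>2) / (4 * \<gamma>)
      = h \<bullet> G y - (D \<bullet> w) / 2 - \<gamma> / 4 * (norm D)\<^sup>2"
    unfolding N unfolding power2_norm_eq_inner using gamma_pos hG
    by (subst nonzero_divide_eq_eq) (auto simp: power2_eq_square algebra_simps)
  moreover have "(pi_dens U y * r y x) / (pi_dens U x * r x y)
     = exp (U x - U y + ((norm w)\<^sup>2 - (norm (w - 2 *\<^sub>R h + \<gamma> *\<^sub>R D))\<^sup>2) / (4 * \<gamma>))"
  proof -
    have "pi_dens U y / pi_dens U x = exp (U x - U y)"
      using Zc_pos by (simp add: pi_dens_def exp_minus exp_diff field_simps)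
    moreover have "r y x / r x y = exp (((norm w)\<^sup>2 - (norm (w - 2 *\<^sub>R h + \<gamma> *\<^sub>R D))\<^sup>2) / (4 * \<gamma>))"
      using gamma_pos unfolding prop_dens_def e w[symmetric]
      by (simp add: exp_diff[symmetric] diff_divide_distrib)
    ultimately show ?thesis by (simp add: exp_add times_divide_times_eq[symmetric] del: times_divide_times_eq)
  qed
  ultimately show ?thesis by (simp add: h_def inner_diff_right inner_diff_left inner_commute algebra_simps)
qed

text \<open>Up to the noise \<open>w\<close>, the move \<open>h\<close> is a gradient step. Far out
  it is short enough for the segment from \<open>y\<close> to \<open>x\<close> to avoid the ball of
  radius \<open>\<kappa>\<close>, and long enough for \<open>m / 2 * (norm h)\<^sup>2\<close> to
  dominate \<open>D \<bullet> w\<close> in \<open>acc_ratio\<close>; \<open>gamma_small\<close>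
  controls the term with \<open>(norm D)\<^sup>2\<close>.\<close>

lemma accepts_far_out:
  "\<exists>R. \<forall>x y. R \<le> norm x \<longrightarrow> norm (y - x + \<gamma> *\<^sub>R G x) \<le> 1 \<longrightarrow> \<alpha> x y = 1"
\<comment> \<open>The first entry gives \<open>norm x / 2 + 1 \<le> norm x - \<kappa>\<close>; the
  second, via \<open>norm_G_ge\<close>, gives
  \<open>\<gamma> * norm (G x) \<ge> 2 * L / m + 1\<close>.\<close>
proof (intro exI[of _ "max (2 * \<kappa> + 2) (((2 * L / m + 1) / \<gamma> + C) / m)"] allI impI)
  fix x y
  assume x: "max (2 * \<kappa> + 2) (((2 * L / m + 1) / \<gamma> + C) / m) \<le> norm x"
    and w1: "norm (y - x + \<gamma> *\<^sub>R G x) \<le> 1"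
  define w where "w = y - x + \<gamma> *\<^sub>R G x"
  \<comment> \<open>The sign is opposite to that of \<open>h\<close> in the proof of
    \<open>acc_ratio\<close>: \<open>U_segment_ge\<close> is used from \<open>y\<close> towards
    \<open>x\<close>.\<close>
  define h where "h = x - y"
  define D where "D = G y - G x"
  have h: "h = \<gamma> *\<^sub>R G x - w" by (simp add: w_def h_def)
  have w: "norm w \<le> 1" using w1 by (simp add: w_def)
  have "norm h \<le> \<gamma> * norm (G x) + norm w"
    using norm_triangle_ineq4[of "\<gamma> *\<^sub>R G x" w] gamma_pos by (simp add: h)
  also have "\<dots> \<le> \<gamma> * (L * norm x) + 1"
    using w norm_G_le gamma_pos by (intro add_mono mult_left_mono) auto
  also have "\<dots> \<le> norm x / 2 + 1"
    using mult_right_mono[OF gamma_L, of "norm x"] by (simp add: mult.assoc)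
  finally have h_up: "norm h \<le> norm x - \<kappa>" using x by simp
  have "(2 * L / m + 1) / \<gamma> + C \<le> norm x * m" using x m by (simp add: pos_divide_le_eq)
  then have "(2 * L / m + 1) / \<gamma> \<le> m * norm x - C" by (simp add: algebra_simps)
  also have "\<dots> \<le> norm (G x)" by (rule norm_G_ge)
  finally have "2 * L / m + 1 \<le> \<gamma> * norm (G x)" using gamma_pos by (simp add: pos_divide_le_eq mult.commute)
  also have "\<dots> \<le> norm h + norm w"
    using norm_triangle_ineq[of h w] gamma_pos by (simp add: h)
  finally have h_low: "2 * L \<le> m * norm h" using w m by (simp add: pos_divide_le_eq[of m, symmetric] mult.commute[of m])
  have "\<kappa> \<le> norm (y + t *\<^sub>R h)" if t: "0 \<le> t" "t \<le> 1" for t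
  proof -
    have "y + t *\<^sub>R h = x - (1 - t) *\<^sub>R h" by (simp add: h_def algebra_simps)
    moreover have "norm ((1 - t) *\<^sub>R h) \<le> norm h" using t by (simp add: mult_left_le_one_le)
    ultimately show ?thesis using norm_triangle_ineq2[of x "(1 - t) *\<^sub>R h"] h_up by simp
  qed
  from U_segment_ge[OF this] have U: "m / 2 * (norm h)\<^sup>2 \<le> U x - U y - G y \<bullet> (x - y)" by (simp add: h_def)
  have Dh: "norm D \<le> L * norm h" using G_lipschitz[of y x] by (simp add: D_def h_def norm_minus_commute)
  have "D \<bullet> w \<le> norm D * norm w" by (rule norm_cauchy_schwarz)
  also have "\<dots> \<le> (L * norm h) * 1" using Dh w L_pos by (intro mult_mono) auto
  finally have Dw: "D \<bullet> w \<le> L * norm h" by simp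
  have "(norm D)\<^sup>2 \<le> (L * norm h)\<^sup>2" using Dh by (intro power_mono) auto
  then have "\<gamma> / 4 * (norm D)\<^sup>2 \<le> \<gamma> / 4 * (L * norm h)\<^sup>2" using gamma_pos by (intro mult_left_mono) auto
  also have "\<dots> = (2 * \<gamma> * L\<^sup>2) * ((norm h)\<^sup>2 / 8)" by (simp add: power_mult_distrib)
  also have "\<dots> \<le> m * ((norm h)\<^sup>2 / 8)" using gamma_small by (intro mult_right_mono) auto
  finally have D2: "\<gamma> / 4 * (norm D)\<^sup>2 \<le> m / 8 * (norm h)\<^sup>2" by simp
  have "2 * L * norm h \<le> m * (norm h)\<^sup>2" using mult_right_mono[OF h_low, of "norm h"] by (simp add: power2_eq_square)
  moreover have "0 \<le> m * (norm h)\<^sup>2" using m by simp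
  \<comment> \<open>In multiples of \<open>(norm h)\<^sup>2\<close>, the gain is
    \<open>m / 2\<close>, while the last two terms cost at most \<open>m / 4\<close> and
    \<open>m / 8\<close>.\<close>
  ultimately have "0 \<le> U x - U y - G y \<bullet> (x - y) - (D \<bullet> w) / 2 - \<gamma> / 4 * (norm D)\<^sup>2"
    using U Dw D2 by simp
  then show "\<alpha> x y = 1" using acc_ratio[OF w_def D_def] by (simp add: acc_prob_def)
qed

text \<open>On the unit ball around its mean the proposal density is at least \<open>c\<close>, and
  far out all these proposals are accepted. Hence \<open>\<delta>\<close> is \<open>c\<close> times
  the volume of the ball.\<close>

lemma rejection_bounded: "\<exists>\<delta>>0. \<exists>R. \<forall>x. R \<le> norm x \<longrightarrow> rej x \<le> 1 - \<delta>"
proof -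
  obtain R where R: "\<And>x y. R \<le> norm x \<Longrightarrow> norm (y - x + \<gamma> *\<^sub>R G x) \<le> 1 \<Longrightarrow> \<alpha> x y = 1"
    using accepts_far_out by blast
  define c where "c = C0 * exp (- 1 / (4 * \<gamma>))"
  define v where "v = measure lborel (cball 0 1 :: 'a set)"
  have c: "0 < c" using C0_pos by (simp add: c_def)
  have v: "0 < v" using content_cball_pos[of 1 "0::'a"] by (simp add: v_def)
  have "rej x \<le> 1 - c * v" if x: "R \<le> norm x" for x
  proof -
    let ?B = "cball (x - \<gamma> *\<^sub>R G x) 1"
    have "c * v = (\<integral>y. c * indicator ?B y \<partial>lborel)" by (simp add: v_def content_cball)
    also have "\<dots> \<le> (\<integral>y. q x y \<partial>lborel)"
    proof (rule integral_mono)
      show "integrable lborel (\<lambda>y. c * indicator ?B y)"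
        using emeasure_lborel_cball_finite[of "x - \<gamma> *\<^sub>R G x" 1] by (intro integrable_mult_right integrable_real_indicator) auto
      fix y
      show "c * indicator ?B y \<le> q x y"
      proof (cases "y \<in> ?B")
        case True
        then have n: "norm (y - x + \<gamma> *\<^sub>R G x) \<le> 1"
          by (simp add: dist_norm norm_minus_commute algebra_simps)
        then have "(norm (y - x + \<gamma> *\<^sub>R G x))\<^sup>2 \<le> 1" by (simp add: abs_square_le_1)
        then have "c \<le> r x y" using gamma_pos C0_pos unfolding c_def prop_dens_def C0_def[symmetric]
          by (auto simp: divide_right_mono)
        then show ?thesis using True R[OF x n] by (simp add: q_def)
      qed (use q_bounds(1) in \<open>simp add: less_imp_le\<close>)
    qed (rule integrable_q)
    finally show ?thesis by (simp add: rej_eq)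
  qed
  then show ?thesis using c v by (intro exI[of _ "c * v"]) auto
qed

text \<open>Young's inequality separates the mean \<open>\<mu>\<close> of the proposal from the
  noise. The noise leaves a Gaussian integral independent of \<open>x\<close>, and the gradient step
  shrinks \<open>(norm \<mu>)\<^sup>2\<close>, so the coefficient of \<open>(norm x)\<^sup>2\<close>
  ends up strictly below the \<open>m / 16\<close> of \<open>V\<close>.\<close>

lemma proposal_V:
  "\<exists>A>0. \<exists>B\<ge>0. \<forall>x. (\<integral>\<^sup>+y. ennreal (V y) * ennreal (r x y) \<partial>lborel)
     \<le> ennreal (A * exp (m / 16 * (1 - \<gamma> * m / 2) * (norm x)\<^sup>2 + B * norm x))"
proof -
  \<comment> \<open>Half of the factor \<open>\<gamma> * m\<close> by which the gradient step
    shrinks the squared norm, so that \<open>(1 + s) * (1 - 2 * s) \<le> 1 - s\<close>.\<close>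
  define s where "s = \<gamma> * m / 2"
  have s: "0 < s" using gamma_pos m by (simp add: s_def)
  \<comment> \<open>What is left of the Gaussian exponent: \<open>m / (16 * s)\<close> is half of
    \<open>1 / (4 * \<gamma>)\<close>, and by \<open>gamma_m\<close> the other half exceeds
    \<open>m / 16\<close>.\<close>
  define c where "c = 1 / (4 * \<gamma>) - m / 16 * (1 + 1 / s)"
  have c: "0 < c"
  proof -
    have "m / 16 * (1 + 1 / s) = m / 16 + 1 / (8 * \<gamma>)" using m gamma_pos by (simp add: s_def field_simps)
    moreover have "m / 16 < 1 / (8 * \<gamma>)" using gamma_m gamma_pos by (simp add: field_simps)
    moreover have "1 / (4 * \<gamma>) = 1 / (8 * \<gamma>) + 1 / (8 * \<gamma>)" using gamma_pos by (simp add: field_simps)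
    ultimately show ?thesis by (simp add: c_def)
  qed
  define A where "A = C0 * (pi / c) powr (DIM('a) / 2)"
  define B where "B = m / 16 * ((1 + s) * (2 * \<gamma> * C))"
  have A: "0 < A" using C0_pos c by (simp add: A_def)
  have B: "0 \<le> B" using m s gamma_pos C_nonneg by (simp add: B_def)
  have "(\<integral>\<^sup>+y. ennreal (V y) * ennreal (r x y) \<partial>lborel)
     \<le> ennreal (A * exp (m / 16 * (1 - \<gamma> * m / 2) * (norm x)\<^sup>2 + B * norm x))" for x
  proof -
    define \<mu> where "\<mu> = x - \<gamma> *\<^sub>R G x"
    define e where "e = m / 16 * ((1 + s) * (norm \<mu>)\<^sup>2)"
    have sq: "(norm (a + b))\<^sup>2 \<le> (1 + s) * (norm a)\<^sup>2 + (1 + 1 / s) * (norm b)\<^sup>2" for a b :: 'a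
    proof -
      have "0 \<le> (norm (s *\<^sub>R a - b))\<^sup>2" by simp
      also have "\<dots> = s\<^sup>2 * (a \<bullet> a) - 2 * s * (a \<bullet> b) + b \<bullet> b"
        unfolding power2_norm_eq_inner by (simp add: inner_simps inner_commute power2_eq_square)
      finally have "0 \<le> (s\<^sup>2 * (a \<bullet> a) - 2 * s * (a \<bullet> b) + b \<bullet> b) / s" using s by simp
      also have "\<dots> = s * (a \<bullet> a) - 2 * (a \<bullet> b) + (b \<bullet> b) / s" using s by (simp add: field_simps power2_eq_square)
      finally show ?thesis
        unfolding power2_norm_eq_inner by (simp add: inner_simps inner_commute algebra_simps)
    qed
    have pt: "V y * r x y \<le> (C0 * exp e) * exp (- c * (norm (y - \<mu>))\<^sup>2)" for y
    proof -
      have "m / 16 * (norm y)\<^sup>2 \<le> m / 16 * ((1 + s) * (norm \<mu>)\<^sup>2 + (1 + 1 / s) * (norm (y - \<mu>))\<^sup>2)"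
        using sq[of \<mu> "y - \<mu>"] m by (intro mult_left_mono) auto
      also have "\<dots> = e + m / 16 * (1 + 1 / s) * (norm (y - \<mu>))\<^sup>2"
        unfolding e_def by (subst distrib_left) (simp only: mult.assoc)
      finally have "m / 16 * (norm y)\<^sup>2 - (1 / (4 * \<gamma>)) * (norm (y - \<mu>))\<^sup>2 \<le> e - c * (norm (y - \<mu>))\<^sup>2"
        by (simp only: c_def left_diff_distrib)
      then have le: "exp (m / 16 * (norm y)\<^sup>2 + - (1 / (4 * \<gamma>)) * (norm (y - \<mu>))\<^sup>2) \<le> exp (e + - c * (norm (y - \<mu>))\<^sup>2)"
        by simp
      show ?thesis
        using mult_left_mono[OF le[unfolded exp_add] less_imp_le[OF C0_pos]]
        unfolding V_def r_eq \<mu>_def[symmetric] C0_def[symmetric] by (simp only: mult_ac)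
    qed
    have "(\<integral>\<^sup>+y. ennreal (V y) * ennreal (r x y) \<partial>lborel)
        \<le> (\<integral>\<^sup>+y. ennreal (C0 * exp e) * ennreal (exp (- c * (norm (y - \<mu>))\<^sup>2)) \<partial>lborel)"
      using pt C0_pos r_pos[of x]
      by (intro nn_integral_mono) (simp add: ennreal_mult[symmetric] less_imp_le V_def)
    also have "\<dots> = ennreal (C0 * exp e) * ennreal ((pi / c) powr (DIM('a) / 2))"
      by (simp add: nn_integral_cmult nn_integral_gaussian[OF c, simplified])
    also have "\<dots> = ennreal (A * exp e)"
      using C0_pos by (simp add: ennreal_mult[symmetric] A_def mult_ac)
    also have "\<dots> \<le> ennreal (A * exp (m / 16 * (1 - \<gamma> * m / 2) * (norm x)\<^sup>2 + B * norm x))"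
    proof -
      \<comment> \<open>By \<open>gamma_small\<close> the term quadratic in \<open>\<gamma>\<close>
        takes back at most half of the gain \<open>2 * \<gamma> * m * (norm x)\<^sup>2\<close> from
        \<open>coercive\<close>.\<close>
      have "(norm (G x))\<^sup>2 \<le> (L * norm x)\<^sup>2" using norm_G_le by (intro power_mono) auto
      then have "\<gamma>\<^sup>2 * (norm (G x))\<^sup>2 \<le> \<gamma>\<^sup>2 * (L * norm x)\<^sup>2" by (intro mult_left_mono) auto
      also have "\<dots> = (\<gamma> * (2 * \<gamma> * L\<^sup>2)) * ((norm x)\<^sup>2 / 2)" by (simp add: power2_eq_square)
      also have "\<dots> \<le> (\<gamma> * m) * ((norm x)\<^sup>2 / 2)"
        using gamma_small gamma_pos by (intro mult_right_mono mult_left_mono) auto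
      also have "\<dots> \<le> (\<gamma> * m) * (norm x)\<^sup>2" using gamma_pos m by (intro mult_left_mono) auto
      finally have g2: "\<gamma>\<^sup>2 * (norm (G x))\<^sup>2 \<le> \<gamma> * m * (norm x)\<^sup>2" .
      have "(norm \<mu>)\<^sup>2 = (norm x)\<^sup>2 - 2 * \<gamma> * (G x \<bullet> x) + \<gamma>\<^sup>2 * (norm (G x))\<^sup>2"
        unfolding power2_norm_eq_inner \<mu>_def by (simp add: inner_simps inner_commute power2_eq_square algebra_simps)
      also have "\<dots> \<le> (norm x)\<^sup>2 - 2 * \<gamma> * (m * (norm x)\<^sup>2 - C * norm x) + \<gamma> * m * (norm x)\<^sup>2"
        using coercive[of x] g2 gamma_pos by (intro add_mono diff_mono mult_left_mono) auto
      finally have "(norm \<mu>)\<^sup>2 \<le> (1 - \<gamma> * m) * (norm x)\<^sup>2 + 2 * \<gamma> * C * norm x" by (simp add: algebra_simps)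
      then have "(1 + s) * (norm \<mu>)\<^sup>2 \<le> (1 + s) * ((1 - \<gamma> * m) * (norm x)\<^sup>2 + 2 * \<gamma> * C * norm x)"
        using s by (intro mult_left_mono) auto
      also have "\<dots> = (1 - s - 2 * s\<^sup>2) * (norm x)\<^sup>2 + (1 + s) * (2 * \<gamma> * C) * norm x"
        by (simp add: s_def power2_eq_square algebra_simps)
      also have "\<dots> \<le> (1 - s) * (norm x)\<^sup>2 + (1 + s) * (2 * \<gamma> * C) * norm x"
        using gamma_pos C_nonneg by (intro add_mono mult_right_mono) auto
      finally have "e \<le> m / 16 * ((1 - s) * (norm x)\<^sup>2 + (1 + s) * (2 * \<gamma> * C) * norm x)"
        unfolding e_def using m by (intro mult_left_mono) auto
      also have "\<dots> = m / 16 * (1 - \<gamma> * m / 2) * (norm x)\<^sup>2 + B * norm x"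
        by (simp add: B_def s_def algebra_simps)
      finally show ?thesis using A by (intro ennreal_leI mult_left_mono iffD2[OF exp_le_cancel_iff]) auto
    qed
    finally show ?thesis .
  qed
  then show ?thesis using A B by blast
qed

text \<open>Far out the proposal contributes at most \<open>\<delta> / 2 * V x\<close> and rejection
  at most \<open>(1 - \<delta>) * V x\<close>. On the remaining ball both are bounded by constants,
  whose sum is \<open>b\<close>.\<close>

lemma drift_condition:
  "\<exists>l b. 0 \<le> l \<and> l < 1 \<and> 0 \<le> b \<and> (\<forall>x. (\<integral>\<^sup>+y. ennreal (V y) \<partial>K x) \<le> ennreal (l * V x + b))"
proof -
  obtain \<delta> R1 where d: "0 < \<delta>" and R1: "\<And>x. R1 \<le> norm x \<Longrightarrow> rej x \<le> 1 - \<delta>"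
    using rejection_bounded by blast
  obtain A B where A: "0 < A" and B: "0 \<le> B" and
    AB: "\<And>x. (\<integral>\<^sup>+y. ennreal (V y) * ennreal (r x y) \<partial>lborel)
     \<le> ennreal (A * exp (m / 16 * (1 - \<gamma> * m / 2) * (norm x)\<^sup>2 + B * norm x))"
    using proposal_V by blast
  define Q where "Q x = A * exp (m / 16 * (1 - \<gamma> * m / 2) * (norm x)\<^sup>2 + B * norm x)" for x :: 'a
  define a where "a = m / 16 * (\<gamma> * m / 2)"
  have a: "0 < a" using m gamma_pos by (simp add: a_def)
  \<comment> \<open>For \<open>u \<ge> R\<close> the rejection bound holds,
    \<open>B * u - a * u\<^sup>2 \<le> - u\<close>, and
    \<open>A * exp (- u) \<le> \<delta> / 2\<close>.\<close>
  define R where "R = max R1 (max ((B + 1) / a) (max 0 (- ln (\<delta> / (2 * A)))))"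
  have R0: "0 \<le> R" by (simp add: R_def)
  have V_pos: "0 < V x" for x by (simp add: V_def)
  have Q_nonneg: "0 \<le> Q x" for x using A by (simp add: Q_def)
  have KV: "(\<integral>\<^sup>+y. ennreal (V y) \<partial>K x) \<le> ennreal (Q x + rej x * V x)" for x
  proof -
    have "(\<integral>\<^sup>+y. ennreal (V y) \<partial>K x) = (\<integral>\<^sup>+y. ennreal (q x y) * ennreal (V y) \<partial>lborel) + ennreal (rej x) * ennreal (V x)"
      by (rule nn_integral_K) simp
    also have "(\<integral>\<^sup>+y. ennreal (q x y) * ennreal (V y) \<partial>lborel) \<le> (\<integral>\<^sup>+y. ennreal (V y) * ennreal (r x y) \<partial>lborel)"
      using q_bounds(2) by (intro nn_integral_mono) (auto simp: mult.commute intro!: mult_left_mono ennreal_leI)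
    also note AB[of x, folded Q_def]
    finally show ?thesis
      using Q_nonneg[of x] V_pos[of x] rej_nonneg[of x] by (simp add: ennreal_mult less_imp_le)
  qed
  have far: "Q x \<le> \<delta> / 2 * V x" if x: "R \<le> norm x" for x
  proof -
    define u where "u = norm x"
    have u: "0 \<le> u" "(B + 1) / a \<le> u" "- ln (\<delta> / (2 * A)) \<le> u" using x by (auto simp: R_def u_def)
    have "B + 1 \<le> a * u" using u(2) a by (simp add: pos_divide_le_eq mult.commute)
    from mult_right_mono[OF this u(1)] have "B * u - a * u\<^sup>2 \<le> - u" by (simp add: power2_eq_square algebra_simps)
    also have "\<dots> \<le> ln (\<delta> / (2 * A))" using u(3) by simp
    finally have "exp (B * u - a * u\<^sup>2) \<le> exp (ln (\<delta> / (2 * A)))" by simp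
    also have "\<dots> = \<delta> / (2 * A)" using d A by (intro exp_ln) simp
    finally have *: "A * exp (B * u - a * u\<^sup>2) \<le> \<delta> / 2" using A by (simp add: field_simps)
    have "Q x = A * exp (B * u - a * u\<^sup>2) * V x"
      by (simp add: Q_def V_def u_def[symmetric] a_def mult.assoc exp_add[symmetric] algebra_simps)
    also have "\<dots> \<le> \<delta> / 2 * V x" using * V_pos[of x] by (intro mult_right_mono) auto
    finally show ?thesis .
  qed
  define b where "b = A * exp (m / 16 * R\<^sup>2 + B * R) + exp (m / 16 * R\<^sup>2)"
  have b: "0 \<le> b" using A by (simp add: b_def)
  \<comment> \<open>\<open>\<delta>\<close> is only known to be positive, hence the truncation at
    \<open>0\<close>.\<close>
  define l where "l = max 0 (1 - \<delta> / 2)"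
  have l: "0 \<le> l" "l < 1" using d by (auto simp: l_def)
  have "Q x + rej x * V x \<le> l * V x + b" for x
  proof (cases "R \<le> norm x")
    case True
    then have "rej x \<le> 1 - \<delta>" by (intro R1) (simp add: R_def)
    then have "rej x * V x \<le> (1 - \<delta>) * V x" using V_pos[of x] by (intro mult_right_mono) auto
    then have "Q x + rej x * V x \<le> (1 - \<delta> / 2) * V x" using far[OF True] by (simp add: algebra_simps)
    also have "\<dots> \<le> l * V x" using V_pos[of x] by (intro mult_right_mono) (auto simp: l_def)
    finally show ?thesis using b by simp
  next
    case False
    have n2: "(norm x)\<^sup>2 \<le> R\<^sup>2" using False by (intro power_mono) auto
    have "0 \<le> (\<integral>y. q x y \<partial>lborel)" using q_bounds(1) by (intro Bochner_Integration.integral_nonneg) (auto simp: less_imp_le)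
    then have "rej x \<le> 1" by (simp add: rej_eq)
    then have "rej x * V x \<le> 1 * V x" using V_pos[of x] by (intro mult_right_mono) auto
    also have "\<dots> \<le> exp (m / 16 * R\<^sup>2)" using n2 m by (simp add: V_def)
    finally have 1: "rej x * V x \<le> exp (m / 16 * R\<^sup>2)" .
    have "m / 16 * (1 - \<gamma> * m / 2) * (norm x)\<^sup>2 \<le> m / 16 * R\<^sup>2"
    proof (rule mult_mono)
      show "m / 16 * (1 - \<gamma> * m / 2) \<le> m / 16"
        using m gamma_pos by (simp add: mult_le_cancel_left1)
    qed (use n2 m in auto)
    moreover have "B * norm x \<le> B * R" using B False by (intro mult_left_mono) auto
    ultimately have "exp (m / 16 * (1 - \<gamma> * m / 2) * (norm x)\<^sup>2 + B * norm x) \<le> exp (m / 16 * R\<^sup>2 + B * R)"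
      by (intro iffD2[OF exp_le_cancel_iff] add_mono)
    then have "Q x \<le> A * exp (m / 16 * R\<^sup>2 + B * R)"
      unfolding Q_def using A by (intro mult_left_mono) auto
    with 1 have "Q x + rej x * V x \<le> b" by (simp add: b_def)
    also have "\<dots> \<le> l * V x + b" using l V_pos[of x] by simp
    finally show ?thesis .
  qed
  then have "\<forall>x. (\<integral>\<^sup>+y. ennreal (V y) \<partial>K x) \<le> ennreal (l * V x + b)"
    by (intro allI order_trans[OF KV ennreal_leI])
  with l b show ?thesis by blast
qed

text \<open>\<open>U_growth\<close> gives the density Gaussian decay with coefficient
  \<open>m / 2\<close>. Absorbing the linear term costs \<open>m / 4\<close> and \<open>V\<close>
  costs \<open>m / 16\<close>, which leaves more than \<open>c = m / 8\<close>.\<close>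

lemma integrable_pi_V: "integrable (pi_meas U) V"
proof -
  define c where "c = m / 8"
  define E where "E = exp (C\<^sup>2 / m - U 0) / Zc U"
  have E: "0 < E" using Zc_pos by (simp add: E_def)
  have le: "pi_dens U x * V x \<le> E * exp (- c * (norm x)\<^sup>2)" for x
  proof -
    define u where "u = norm x"
    have "0 \<le> (m / 2 * u - C)\<^sup>2 / m" using m by simp
    also have "\<dots> = m / 4 * u\<^sup>2 - C * u + C\<^sup>2 / m" using m by (simp add: power2_eq_square field_simps)
    finally have "C * u \<le> m / 4 * u\<^sup>2 + C\<^sup>2 / m" by simp
    moreover have "0 \<le> m * u\<^sup>2" using m by simp
    ultimately have "m / 16 * u\<^sup>2 - U x \<le> (C\<^sup>2 / m - U 0) - c * u\<^sup>2"
      using U_growth[of x] unfolding u_def[symmetric] c_def by simp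
    then have "exp (m / 16 * u\<^sup>2 + - U x) \<le> exp ((C\<^sup>2 / m - U 0) + - c * u\<^sup>2)" by simp
    then have "exp (m / 16 * u\<^sup>2 + - U x) / Zc U \<le> exp ((C\<^sup>2 / m - U 0) + - c * u\<^sup>2) / Zc U"
      using Zc_pos by (intro divide_right_mono) auto
    then show ?thesis
      unfolding exp_add E_def V_def pi_dens_def u_def[symmetric] by (simp add: mult_ac)
  qed
  have "(\<integral>\<^sup>+x. ennreal (V x) \<partial>pi_meas U) = (\<integral>\<^sup>+x. ennreal (pi_dens U x) * ennreal (V x) \<partial>lborel)"
    unfolding pi_meas_def by (subst nn_integral_density) auto
  also have "\<dots> \<le> (\<integral>\<^sup>+x. ennreal E * ennreal (exp (- c * (norm (x - (0::'a)))\<^sup>2)) \<partial>lborel)"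
    using le E pi_pos by (intro nn_integral_mono) (simp add: ennreal_mult[symmetric] less_imp_le V_def)
  also have "\<dots> = ennreal E * ennreal ((pi / c) powr (DIM('a) / 2))"
    using m nn_integral_gaussian[of c "0::'a"] by (simp add: nn_integral_cmult c_def)
  also have "\<dots> < \<infinity>" by (simp add: ennreal_mult_less_top)
  finally show ?thesis by (intro integrableI_nonneg) (auto simp: V_def)
qed

text \<open>The sublevel set of \<open>V\<close> needed for \<open>harris_kernel\<close> lies in a
  ball of radius \<open>S\<close>, where \<open>minorization\<close> applies. Since
  \<open>V \<ge> 1\<close>, the constants in the resulting bound are absorbed into a multiple of
  \<open>V x\<close>.\<close>

lemma geometric_ergodicity:
  "\<exists>C\<ge>0. \<exists>\<rho>\<in>{0..<1}. \<forall>x k. vnorm V (mala_iter U G \<gamma> x k) (pi_meas U) \<le> ereal (C * \<rho> ^ k * V x)"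
proof -
  have V1: "1 \<le> V x" and V0: "0 \<le> V x" for x using m by (auto simp: V_def)
  obtain l b where lb: "0 \<le> l" "l < 1" "0 \<le> b"
    and drift: "\<And>x. (\<integral>\<^sup>+y. ennreal (V y) \<partial>K x) \<le> ennreal (l * V x + b)"
    using drift_condition by blast
  \<comment> \<open>The \<open>+ 1\<close> keeps \<open>R\<close> positive when
    \<open>b = 0\<close>.\<close>
  define R where "R = 4 * b / (1 - l) + 1"
  have R: "1 \<le> R" "4 * b / (1 - l) \<le> R" using lb by (auto simp: R_def)
  define S where "S = sqrt (16 / m * ln R)"
  have S: "norm x \<le> S" if "V x \<le> R" for x
  proof -
    have "m / 16 * (norm x)\<^sup>2 \<le> ln R" using that R ln_mono[of "V x" R] by (simp add: V_def)
    then have "(norm x)\<^sup>2 \<le> 16 / m * ln R" using m by (simp add: field_simps)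
    then show ?thesis unfolding S_def by (rule real_le_rsqrt)
  qed
  obtain \<epsilon> where eps: "0 < \<epsilon>" and min: "\<And>x g. norm x \<le> S \<Longrightarrow> g \<in> borel_measurable borel \<Longrightarrow>
     ennreal \<epsilon> * (\<integral>\<^sup>+y. g y \<partial>uniform_measure lborel (cball 0 1)) \<le> (\<integral>\<^sup>+y. g y \<partial>K x)"
    using minorization[of S] by blast
  have "emeasure lborel (cball 0 1 :: 'a set) \<noteq> 0"
    using content_cball_pos[of 1 "0::'a"] by (auto simp: measure_def)
  then have nu: "prob_space (uniform_measure lborel (cball 0 1 :: 'a set))"
    using emeasure_lborel_cball_finite[of "0::'a" 1] by (intro prob_space_uniform_measure) auto
  interpret hk: harris_kernel K V l b R \<epsilon> "uniform_measure lborel (cball 0 1)"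
  proof (intro harris_kernel.intro drift_kernel.intro harris_kernel_axioms.intro)
    show "4 * b / (1 - l) \<le> R" "0 < R" using R by auto
    show "sets (uniform_measure lborel (cball 0 1)) = sets (borel :: 'a measure)" by simp
    show "ennreal \<epsilon> * (\<integral>\<^sup>+y. g y \<partial>uniform_measure lborel (cball 0 1)) \<le> (\<integral>\<^sup>+y. g y \<partial>K x)"
      if "V x \<le> R" "g \<in> borel_measurable borel" for x g
      using that S by (intro min)
  qed (fact V0 lb drift eps nu K_measurable V_borel)+
  define M where "M = (\<integral>y. hk.W y \<partial>pi_meas U)"
  have M: "0 \<le> M"
    unfolding M_def by (intro Bochner_Integration.integral_nonneg order_trans[OF zero_le_one hk.W_ge_1])
  define C where "C = (1 + hk.\<beta> + M) / hk.\<beta>"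
  have C: "0 \<le> C" using hk.beta M by (simp add: C_def)
  have it: "mala_iter U G \<gamma> x k = hk.iter x k" for x k
    by (induction k) (simp_all add: hk.iter_def)
  have "vnorm V (mala_iter U G \<gamma> x k) (pi_meas U) \<le> ereal (C * hk.rate ^ k * V x)" for x k
  proof -
    have "\<bar>(\<integral>y. f y \<partial>hk.iter x k) - (\<integral>y. f y \<partial>pi_meas U)\<bar> \<le> C * hk.rate ^ k * V x"
      if f: "f \<in> borel_measurable borel" "\<And>x. \<bar>f x\<bar> \<le> V x" for f
    proof -
      have "\<bar>(\<integral>y. f y \<partial>hk.iter x k) - (\<integral>y. f y \<partial>pi_meas U)\<bar> \<le> hk.rate ^ k * (hk.W x + M) / hk.\<beta>"
        unfolding M_def using prob_space_pi integrable_pi_V pi_invariant f by (intro hk.harris) auto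
      also have "hk.W x + M \<le> (1 + hk.\<beta> + M) * V x"
        using V1[of x] M mult_left_mono[OF V1[of x] M] by (simp add: hk.W_def algebra_simps)
      then have "hk.rate ^ k * (hk.W x + M) / hk.\<beta> \<le> hk.rate ^ k * ((1 + hk.\<beta> + M) * V x) / hk.\<beta>"
        using hk.rate hk.beta by (intro divide_right_mono mult_left_mono) auto
      also have "\<dots> = C * hk.rate ^ k * V x" by (simp add: C_def)
      finally show ?thesis .
    qed
    \<comment> \<open>Integrability of \<open>V\<close> under both laws selects the finite branch of
      \<open>vnorm\<close>.\<close>
    then show ?thesis
      unfolding vnorm_def it using integrable_pi_V hk.iter_props[of x k] by (auto intro!: SUP_least)
  qed
  with C hk.rate show ?thesis by (intro exI[of _ C] conjI bexI[of _ hk.rate]) auto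
qed

end

theorem theorem1:
  fixes U :: "'a::euclidean_space \<Rightarrow> real"
    and G :: "'a \<Rightarrow> 'a"
    and H :: "'a \<Rightarrow> 'a \<Rightarrow>\<^sub>L 'a"
    and L m K :: real
  assumes grad: "\<And>x. (U has_derivative (\<lambda>h. G x \<bullet> h)) (at x)"
    and hess: "\<And>x. (G has_derivative blinfun_apply (H x)) (at x)"
    and hess_cont: "continuous_on UNIV H"
    and grad0: "G 0 = 0"
    and L: "L \<ge> 0" "\<And>x. norm (H x) \<le> L"
    and m: "m > 0" and K: "K \<ge> 0"
    and convex_out: "\<And>x y. norm x \<ge> K \<Longrightarrow> norm y = 1 \<Longrightarrow> blinfun_apply (H x) y \<bullet> y \<ge> m"
    and integ: "integrable lborel (\<lambda>y. exp (- U y))"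
  shows "\<exists>\<Gamma>>0. \<forall>\<gamma>\<in>{0<..\<Gamma>}. \<exists>C\<ge>0. \<exists>\<rho>\<in>{0..<1}. \<forall>x k.
           vnorm (\<lambda>z. exp (m / 16 * (norm z)\<^sup>2)) (mala_iter U G \<gamma> x k) (pi_meas U)
             \<le> ereal (C * \<rho> ^ k * exp (m / 16 * (norm x)\<^sup>2))"
proof -
  interpret potential U G H L m K
    by unfold_locales (fact grad hess grad0 L(2) m K convex_out)+
  show ?thesis
  \<comment> \<open>The largest step size that \<open>gamma_small\<close> admits; \<open>L\<close>
    is positive because \<open>m \<le> L\<close>.\<close>
  proof (rule exI[of _ "m / (2 * L\<^sup>2)"], intro conjI ballI)
    show "0 < m / (2 * L\<^sup>2)" using m L_pos by simp
    fix \<gamma> assume g: "\<gamma> \<in> {0<..m / (2 * L\<^sup>2)}"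
    interpret mp: mala_potential U G H L m K \<gamma>
    proof unfold_locales
      show "integrable lborel (\<lambda>y. exp (- U y))" by (fact integ)
      show "0 < \<gamma>" using g by simp
      have "\<gamma> * (2 * L\<^sup>2) \<le> m" using g L_pos by (simp add: pos_le_divide_eq)
      then show "2 * \<gamma> * L\<^sup>2 \<le> m" by (simp add: mult_ac)
    qed
    show "\<exists>C\<ge>0. \<exists>\<rho>\<in>{0..<1}. \<forall>x k.
           vnorm (\<lambda>z. exp (m / 16 * (norm z)\<^sup>2)) (mala_iter U G \<gamma> x k) (pi_meas U)
             \<le> ereal (C * \<rho> ^ k * exp (m / 16 * (norm x)\<^sup>2))"
      using mp.geometric_ergodicity unfolding mp.V_def[abs_def] .
  qed
qed

end
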